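(* Let $G$ be a finite simple graph with at least one edge, on vertex set $\{x_1,\ldots,x_n\}$, let $\mathbb{K}$ be a field and $R=\mathbb{K}[x_1,\ldots,x_n]$. Then $$\mathrm{v}(J(G)^{(k)})\le\mathrm{reg}(R/J(G)^{(k)})\quad\text{for all }k\ge 1.$$
   Context: $R$ has its standard grading. The cover ideal of $G$ is $J(G)=\bigcap_{\{x_i,x_j\}\in E(G)}(x_i,x_j)\subset R$; equivalently it is generated by the monomials $\prod_{x_i\in C}x_i$, with $C$ a minimal vertex cover of $G$. The $k$-th symbolic power of an ideal $I$ is $I^{(k)}=\bigcap_{P\in\mathrm{Min}(I)}(I^kR_P\cap R)$ (for square-free monomial $I$, $\mathrm{Min}(I)=\mathrm{Ass}(R/I)$). For a proper graded ideal $J\subset R$, the v-number is $\mathrm{v}(J)=\min\{d\ge 0\mid \exists f\in R_d,\ \mathfrak{p}\in\mathrm{Ass}(J)\text{ with }(J:f)=\mathfrak{p}\}$, where $\mathrm{Ass}(J)$ is the set of associated primes of $R/J$, and $\mathrm{reg}(R/J)=\max\{j-i\mid\beta_{i,j}(R/J)\ne 0\}$ is the Castelnuovo-Mumford regularity ($\beta_{i,j}$ the graded Betti numbers). *)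

theory Defs
  imports
    "HOL-Library.Poly_Mapping"
    "Jordan_Normal_Form.Matrix_Kernel"
begin

section \<open>Ideals of a commutative ring\<close>

text \<open>Ideals of a ring of class \<open>comm_ring_1\<close> are the submodules of the ring over itself.\<close>

global_interpretation ring_as_module: module "(*) :: 'a::comm_ring_1 \<Rightarrow> 'a \<Rightarrow> 'a"
  defines is_ideal = ring_as_module.subspace
    and ideal_gen = ring_as_module.span
  by unfold_locales (simp_all add: algebra_simps)

definition prime_ideal :: "'a::comm_ring_1 set \<Rightarrow> bool" where
  "prime_ideal P \<longleftrightarrow> is_ideal P \<and> 1 \<notin> P \<and> (\<forall>a b. a * b \<in> P \<longrightarrow> a \<in> P \<or> b \<in> P)"

definition ideal_prod :: "'a::comm_ring_1 set \<Rightarrow> 'a set \<Rightarrow> 'a set" where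
  "ideal_prod I J = ideal_gen {a * b | a b. a \<in> I \<and> b \<in> J}"

primrec ideal_power :: "'a::comm_ring_1 set \<Rightarrow> nat \<Rightarrow> 'a set" where
  "ideal_power I 0 = UNIV"
| "ideal_power I (Suc k) = ideal_prod I (ideal_power I k)"

definition colon :: "'a::comm_ring_1 set \<Rightarrow> 'a \<Rightarrow> 'a set" where
  "colon I f = {g. g * f \<in> I}"

definition Min_primes :: "'a::comm_ring_1 set \<Rightarrow> 'a set set" where
  "Min_primes I = {P. prime_ideal P \<and> I \<subseteq> P \<and>
     (\<forall>Q. prime_ideal Q \<and> I \<subseteq> Q \<and> Q \<subseteq> P \<longrightarrow> Q = P)}"

text \<open>\<open>Ass I\<close> is the set of associated primes of \<open>R/I\<close>: the annihilator of the
  class of \<open>f\<close> in \<open>R/I\<close> is \<open>(I : f)\<close>.\<close>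

definition Ass :: "'a::comm_ring_1 set \<Rightarrow> 'a set set" where
  "Ass I = {P. prime_ideal P \<and> (\<exists>f. colon I f = P)}"

text \<open>The contraction \<open>I R\<^sub>P \<inter> R\<close>, i.e. the preimage of \<open>I R\<^sub>P\<close> under \<open>R \<rightarrow> R\<^sub>P\<close>: for an ideal \<open>I\<close>,
  \<open>f/1 = a/t\<close> in \<open>R\<^sub>P\<close> with \<open>a \<in> I\<close>, \<open>t \<notin> P\<close> means \<open>u (t f - a) = 0\<close> for some \<open>u \<notin> P\<close>,
  i.e. \<open>s f \<in> I\<close> for some \<open>s \<notin> P\<close>.\<close>

definition local_contraction :: "'a::comm_ring_1 set \<Rightarrow> 'a set \<Rightarrow> 'a set" where
  "local_contraction I P = {f. \<exists>s. s \<notin> P \<and> s * f \<in> I}"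

definition symbolic_power :: "'a::comm_ring_1 set \<Rightarrow> nat \<Rightarrow> 'a set" where
  "symbolic_power I k = (\<Inter>P\<in>Min_primes I. local_contraction (ideal_power I k) P)"


section \<open>The standard graded polynomial ring\<close>

text \<open>The polynomial ring over \<open>'k\<close> whose variables are indexed by the finite type \<open>'n\<close>.\<close>

type_synonym ('n, 'k) mpoly = "('n \<Rightarrow>\<^sub>0 nat) \<Rightarrow>\<^sub>0 'k"

definition Var :: "'n \<Rightarrow> ('n, 'k::field) mpoly" where
  "Var i = Poly_Mapping.single (Poly_Mapping.single i 1) 1"

definition mdeg :: "('n::finite \<Rightarrow>\<^sub>0 nat) \<Rightarrow> nat" where
  "mdeg m = (\<Sum>i\<in>UNIV. Poly_Mapping.lookup m i)"

definition graded_part :: "nat \<Rightarrow> ('n::finite, 'k::field) mpoly set" where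
  "graded_part d = {f. \<forall>m\<in>Poly_Mapping.keys f. mdeg m = d}"

definition v_number :: "('n::finite, 'k::field) mpoly set \<Rightarrow> nat" where
  "v_number J = (LEAST d. \<exists>f\<in>graded_part d. \<exists>P\<in>Ass J. colon J f = P)"


section \<open>Graded Betti numbers and regularity\<close>

text \<open>A minimal graded free resolution
  \<open>0 \<rightarrow> F\<^sub>p \<rightarrow> \<dots> \<rightarrow> F\<^sub>1 \<rightarrow> F\<^sub>0 = R \<rightarrow> R/J \<rightarrow> 0\<close> of \<open>R/J\<close> for a proper graded ideal \<open>J\<close>.
  Here \<open>D i\<close> lists the degrees of a homogeneous basis of \<open>F\<^sub>i\<close>, so \<open>F\<^sub>i = \<Oplus>\<^sub>c R(- D i ! c)\<close>,
  and \<open>A i\<close> is the matrix of the differential \<open>F\<^sub>i\<^sub>+\<^sub>1 \<rightarrow> F\<^sub>i\<close>. Homogeneity of the differential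
  means that its \<open>(r, c)\<close> entry is zero or homogeneous of degree \<open>D (Suc i) ! c - D i ! r\<close>;
  minimality means that all entries lie in the ideal generated by the variables.\<close>

definition min_graded_free_resolution ::
  "('n::finite, 'k::field) mpoly set \<Rightarrow> (nat \<Rightarrow> nat list) \<Rightarrow> (nat \<Rightarrow> ('n, 'k) mpoly mat) \<Rightarrow> bool"
where
  "min_graded_free_resolution J D A \<longleftrightarrow>
     D 0 = [0] \<and>
     (\<exists>p. \<forall>i>p. D i = []) \<and>
     (\<forall>i. A i \<in> carrier_mat (length (D i)) (length (D (Suc i)))) \<and>
     (\<forall>i. \<forall>r<length (D i). \<forall>c<length (D (Suc i)).
        (\<forall>m\<in>Poly_Mapping.keys (A i $$ (r, c)). mdeg m + D i ! r = D (Suc i) ! c) \<and>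
        A i $$ (r, c) \<in> ideal_gen (range Var)) \<and>
     {(A 0 *\<^sub>v v) $ 0 | v. v \<in> carrier_vec (length (D 1))} = J \<and>
     (\<forall>i. mat_kernel (A i) = {A (Suc i) *\<^sub>v v | v. v \<in> carrier_vec (length (D (Suc (Suc i))))})"

text \<open>\<open>betti J i j\<close> is the graded Betti number \<open>\<beta>\<^sub>i\<^sub>,\<^sub>j(R/J)\<close>, the multiplicity of \<open>R(-j)\<close> in \<open>F\<^sub>i\<close>.
  Minimal graded free resolutions exist (and are finite, by Hilbert's syzygy theorem) and are
  unique up to isomorphism, so the value does not depend on the chosen one.\<close>

definition betti :: "('n::finite, 'k::field) mpoly set \<Rightarrow> nat \<Rightarrow> nat \<Rightarrow> nat" where
  "betti J i j = count_list ((SOME D. \<exists>A. min_graded_free_resolution J D A) i) j"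

text \<open>\<open>reg_quot J\<close> is the Castelnuovo--Mumford regularity of \<open>R/J\<close>.\<close>

definition reg_quot :: "('n::finite, 'k::field) mpoly set \<Rightarrow> int" where
  "reg_quot J = Max {int j - int i | i j. betti J i j \<noteq> 0}"


section \<open>Simple graphs and cover ideals\<close>

text \<open>A simple graph with vertex set the finite type \<open>'n\<close> is given by its set of edges.\<close>

definition simple_graph :: "'n set set \<Rightarrow> bool" where
  "simple_graph E \<longleftrightarrow> (\<forall>e\<in>E. card e = 2)"

definition cover_ideal :: "'n set set \<Rightarrow> ('n, 'k::field) mpoly set" where
  "cover_ideal E = (\<Inter>e\<in>E. ideal_gen (Var ` e))"

end

theory Submission
  imports Defs
begin

text \<open>
  The symbolic power \<open>J\<close> is the monomial ideal of all exponents \<open>u\<close> with \<open>u\<^sub>i + u\<^sub>j \<ge> k\<close> for every edge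
  \<open>{i, j}\<close>. Choose a multidegree \<open>b\<close> that is minimal subject to the monomials of \<open>J\<close> dividing
  \<open>x\<^sup>b\<close> not all being multiples of one of them. Up to a monomial factor, these monomials generate
  the cover ideal of a complete multipartite graph, which has two consequences. First,
  \<open>x\<^sup>b / (x\<^sub>p x\<^sub>q)\<close> has colon ideal \<open>(x\<^sub>p, x\<^sub>q)\<close> for an edge \<open>{p, q}\<close>, so the v-number is at most
  \<open>|b| - 2\<close>. Secondly, the monomials of \<open>J\<close> properly dividing \<open>x\<^sup>b\<close> fall into classes that do not
  interact, so there is a minimal first syzygy of degree \<open>|b|\<close>, whence \<open>\<beta>\<^sub>2(R/J)\<close> is nonzero in
  degree \<open>|b|\<close> and the regularity is at least \<open>|b| - 2\<close>.

  Since Betti numbers are read off a chosen resolution, its existence matters too. For monomial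
  ideals, multigraded minimal generators can be chosen by linear algebra in each multidegree.
\<close>

text \<open>Both bounds come from the single multidegree \<open>b\<close>, and the 2 arises
  independently on each side: as the two variables removed from \<open>x^b\<close>, and as the
  homological degree of the syzygy. Minimality of \<open>b\<close> is used through its consequence
  that every multidegree properly below \<open>b\<close> has either no monomial of \<open>J\<close>
  below it or a least one. The obstacle on the Betti side is that the resolution picked by
  \<open>betti\<close> is graded by total degree only: its generators need not be monomials and its
  matrices need not be multihomogeneous, so \<open>b\<close> has no direct meaning in it. The syzygy
  is therefore detected through single coefficients, after truncating the generators to the
  multiples of one monomial. This is done for every minimal resolution, hence for the chosen one.
  Finite length of the resolution matters as well, since \<open>reg_quot\<close> is a
  \<open>Max\<close> over a set that has to be shown finite.\<close>

abbreviation "lookup \<equiv> Poly_Mapping.lookup"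
abbreviation "keys \<equiv> Poly_Mapping.keys"
abbreviation "single \<equiv> Poly_Mapping.single"

section \<open>Monomials and coefficients\<close>

definition mle :: "('n \<Rightarrow>\<^sub>0 nat) \<Rightarrow> ('n \<Rightarrow>\<^sub>0 nat) \<Rightarrow> bool" (infix "\<preceq>" 50)
  where "u \<preceq> v \<longleftrightarrow> (\<forall>i. lookup u i \<le> lookup v i)"

lemma mleD: "u \<preceq> v \<Longrightarrow> lookup u i \<le> lookup v i"
  by (simp add: mle_def)

lemma mle_refl [simp]: "u \<preceq> u"
  by (simp add: mle_def)

lemma mle_trans [trans]: "u \<preceq> v \<Longrightarrow> v \<preceq> w \<Longrightarrow> u \<preceq> w"
  unfolding mle_def using le_trans by blast

lemma zero_mle [simp]: "0 \<preceq> u"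
  by (simp add: mle_def)

lemma mle_add [simp]: "u \<preceq> u + v" "v \<preceq> u + v"
  by (simp_all add: mle_def lookup_add)

lemma mle_diff_add [simp]: "u \<preceq> v \<Longrightarrow> v - u + u = v" "u \<preceq> v \<Longrightarrow> u + (v - u) = v"
  by (auto intro!: poly_mapping_eqI simp: mle_def lookup_add lookup_minus)

lemma diff_mle [simp]: "v - u \<preceq> v"
  by (simp add: mle_def lookup_minus)

lemma add_mle_iff: "u + v \<preceq> w \<longleftrightarrow> u \<preceq> w \<and> v \<preceq> w - u"
proof
  assume *: "u + v \<preceq> w"
  have "lookup u i \<le> lookup w i \<and> lookup v i \<le> lookup w i - lookup u i" for i
    using mleD[OF *, of i] by (simp add: lookup_add)
  then show "u \<preceq> w \<and> v \<preceq> w - u"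
    by (simp add: mle_def lookup_minus)
next
  assume "u \<preceq> w \<and> v \<preceq> w - u"
  then have "lookup u i \<le> lookup w i" "lookup v i \<le> lookup w i - lookup u i" for i
    by (auto dest: mleD[where i=i] simp: lookup_minus)
  then have "lookup u i + lookup v i \<le> lookup w i" for i
    by (metis le_diff_conv2 add.commute)
  then show "u + v \<preceq> w"
    by (simp add: mle_def lookup_add)
qed

lemma add_eq_iff_mle: "u + v = w \<longleftrightarrow> u \<preceq> w \<and> v = w - u" for w :: "'n \<Rightarrow>\<^sub>0 nat"
  by (metis mle_add(1) mle_diff_add(2) add_diff_cancel_left')

lemma mdeg_add: "mdeg (u + v) = mdeg u + mdeg v"
  by (simp add: mdeg_def lookup_add sum.distrib)

lemma mdeg_diff: "u \<preceq> v \<Longrightarrow> mdeg (v - u) + mdeg u = mdeg v"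
  by (metis mdeg_add mle_diff_add(1))

lemma mdeg_mono: "u \<preceq> v \<Longrightarrow> mdeg u \<le> mdeg v"
  by (auto simp: mdeg_def mle_def intro: sum_mono)

lemma mdeg_eq_0_iff [simp]: "mdeg u = 0 \<longleftrightarrow> u = 0"
  by (auto simp: mdeg_def intro: poly_mapping_eqI)

lemma mdeg_strict_mono:
  assumes "u \<preceq> v" "u \<noteq> v"
  shows "mdeg u < mdeg v"
proof -
  have "v - u \<noteq> 0"
    using assms by (metis add_0 mle_diff_add(1))
  then show ?thesis
    using mdeg_diff[OF assms(1)] mdeg_eq_0_iff[of "v - u"] by linarith
qed

text \<open>Every function on the finite type \<open>'n\<close> has finite support, so
  \<open>Abs_poly_mapping\<close> is always applied within its domain.\<close>

definition mk :: "('n::finite \<Rightarrow> nat) \<Rightarrow> 'n \<Rightarrow>\<^sub>0 nat"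
  where "mk f = Abs_poly_mapping f"

lemma lookup_mk [simp]: "lookup (mk f) i = f i"
  by (simp add: mk_def)

lemma lookup_single_Suc_0 [simp]: "lookup (single i (Suc 0)) j = (if i = j then 1 else 0)"
  by (simp add: lookup_single when_def)

lemma finite_below: "finite {u :: 'n::finite \<Rightarrow>\<^sub>0 nat. u \<preceq> v}"
proof (rule finite_surj)
  show "finite (PiE UNIV (\<lambda>i. {..lookup v i}))"
    by (intro finite_PiE) auto
  show "{u. u \<preceq> v} \<subseteq> mk ` PiE UNIV (\<lambda>i. {..lookup v i})"
  proof
    fix u assume "u \<in> {u. u \<preceq> v}"
    then have "lookup u \<in> PiE UNIV (\<lambda>i. {..lookup v i})"
      by (auto simp: mle_def)
    moreover have "u = mk (lookup u)"
      by (auto intro: poly_mapping_eqI)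
    ultimately show "u \<in> mk ` PiE UNIV (\<lambda>i. {..lookup v i})"
      by blast
  qed
qed

lemma sum_single: "(\<Sum>m\<in>keys p. single m (lookup p m)) = p"
  by (rule poly_mapping_eqI)
    (auto simp: lookup_sum lookup_single when_def in_keys_iff sum.delta)

lemma lookup_single_times:
  fixes p :: "('n \<Rightarrow>\<^sub>0 nat) \<Rightarrow>\<^sub>0 'k::comm_ring_1"
  shows "lookup (single m a * p) g = (if m \<preceq> g then a * lookup p (g - m) else 0)"
proof -
  have "lookup (single m a * p) g =
      (\<Sum>u\<in>keys p. lookup (single m a * single u (lookup p u)) g)"
    by (subst sum_single[of p, symmetric]) (simp only: sum_distrib_left lookup_sum)
  also have "\<dots> = (\<Sum>u\<in>keys p. if m \<preceq> g \<and> u = g - m then a * lookup p u else 0)"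
    by (intro sum.cong) (auto simp: mult_single lookup_single when_def add_eq_iff_mle)
  also have "\<dots> = (if m \<preceq> g then a * lookup p (g - m) else 0)"
    by (auto simp: sum.delta' in_keys_iff)
  finally show ?thesis .
qed

lemma lookup_times:
  fixes p q :: "('n \<Rightarrow>\<^sub>0 nat) \<Rightarrow>\<^sub>0 'k::comm_ring_1"
  shows "lookup (p * q) g =
    (\<Sum>m\<in>keys p. if m \<preceq> g then lookup p m * lookup q (g - m) else 0)"
proof -
  show ?thesis
    by (subst sum_single[of p, symmetric])
      (simp only: sum_distrib_right lookup_sum lookup_single_times)
qed

lemma keys_timesE:
  fixes p q :: "('n \<Rightarrow>\<^sub>0 nat) \<Rightarrow>\<^sub>0 'k::comm_ring_1"
  assumes "m \<in> keys (p * q)"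
  obtains u v where "u \<in> keys p" "v \<in> keys q" "m = u + v"
  using assms keys_mult[of p q] by auto

section \<open>Monomial ideals\<close>

text \<open>Described by support, so that membership is a condition on exponents. For an
  \<open>up_closed\<close> set it is the ideal generated by the monomials with exponent in
  \<open>M\<close>.\<close>

definition mono_ideal :: "('n \<Rightarrow>\<^sub>0 nat) set \<Rightarrow> ('n, 'k::field) mpoly set"
  where "mono_ideal M = {f. keys f \<subseteq> M}"

definition up_closed :: "('n \<Rightarrow>\<^sub>0 nat) set \<Rightarrow> bool"
  where "up_closed M \<longleftrightarrow> (\<forall>u\<in>M. \<forall>v. u \<preceq> v \<longrightarrow> v \<in> M)"

lemma up_closedD: "up_closed M \<Longrightarrow> u \<in> M \<Longrightarrow> u \<preceq> v \<Longrightarrow> v \<in> M"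
  by (auto simp: up_closed_def)

lemma single_in_mono_ideal [simp]: "single m a \<in> mono_ideal M \<longleftrightarrow> a = 0 \<or> m \<in> M"
  by (auto simp: mono_ideal_def)

lemma is_ideal_mono_ideal:
  assumes "up_closed M"
  shows "is_ideal (mono_ideal M :: ('n, 'k::field) mpoly set)"
proof (rule ring_as_module.subspaceI)
  fix f g :: "('n, 'k) mpoly"
  assume "f \<in> mono_ideal M" "g \<in> mono_ideal M"
  then show "f + g \<in> mono_ideal M"
    using keys_add[of f g] by (auto simp: mono_ideal_def)
next
  fix c f :: "('n, 'k) mpoly"
  assume "f \<in> mono_ideal M"
  then show "c * f \<in> mono_ideal M"
    using up_closedD[OF assms] by (auto simp: mono_ideal_def elim!: keys_timesE)
qed (auto simp: mono_ideal_def)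

lemma mono_ideal_subset_ideal:
  fixes I :: "('n, 'k::field) mpoly set"
  assumes I: "is_ideal I" and M: "\<And>m. m \<in> M \<Longrightarrow> single m 1 \<in> I"
  shows "mono_ideal M \<subseteq> I"
proof
  fix f :: "('n, 'k) mpoly"
  assume "f \<in> mono_ideal M"
  then have "single m (lookup f m) \<in> I" if "m \<in> keys f" for m
    using ring_as_module.subspace_scale[OF I M[of m], of "single 0 (lookup f m)"] that
    by (auto simp: mono_ideal_def mult_single)
  then have "(\<Sum>m\<in>keys f. single m (lookup f m)) \<in> I"
    by (intro ring_as_module.subspace_sum[OF I]) auto
  then show "f \<in> I"
    by (simp add: sum_single)
qed

lemma ideal_gen_Var:
  "ideal_gen (Var ` S) = (mono_ideal {m. \<exists>i\<in>S. lookup m i \<noteq> 0} :: ('n, 'k::field) mpoly set)"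
  (is "_ = mono_ideal ?M")
proof
  have up: "up_closed ?M"
    unfolding up_closed_def
  proof (intro ballI allI impI)
    fix u v assume "u \<in> ?M" and uv: "u \<preceq> v"
    then obtain i where "i \<in> S" "lookup u i \<noteq> 0"
      by auto
    moreover have "lookup u i \<le> lookup v i"
      by (rule mleD[OF uv])
    ultimately have "i \<in> S" "lookup v i \<noteq> 0"
      by auto
    then show "v \<in> ?M"
      by blast
  qed
  show "ideal_gen (Var ` S) \<subseteq> (mono_ideal ?M :: ('n, 'k) mpoly set)"
    by (rule ring_as_module.span_minimal[OF _ is_ideal_mono_ideal[OF up]])
      (auto simp: Var_def lookup_single when_def)
  show "mono_ideal ?M \<subseteq> (ideal_gen (Var ` S) :: ('n, 'k) mpoly set)"
  proof (rule mono_ideal_subset_ideal)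
    show "is_ideal (ideal_gen (Var ` S) :: ('n, 'k) mpoly set)"
      by (rule ring_as_module.subspace_span)
    fix m :: "'n \<Rightarrow>\<^sub>0 nat" assume "m \<in> ?M"
    then obtain i where i: "i \<in> S" "lookup m i \<noteq> 0"
      by auto
    then have "single i 1 \<preceq> m"
      by (auto simp: mle_def)
    then have "single m (1::'k) = single (m - single i 1) 1 * Var i"
      by (simp add: Var_def mult_single)
    then show "single m 1 \<in> (ideal_gen (Var ` S) :: ('n, 'k) mpoly set)"
      using i by (simp add: ring_as_module.span_base ring_as_module.span_scale)
  qed
qed

section \<open>Symbolic powers of cover ideals\<close>

text \<open>The order of vanishing along the prime generated by the variables in \<open>e\<close>:
  the exponents with \<open>k \<le> wt e m\<close> are those of the monomials in the
  \<open>k\<close>-th power of that prime.\<close>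

definition wt :: "'n set \<Rightarrow> ('n \<Rightarrow>\<^sub>0 nat) \<Rightarrow> nat"
  where "wt e m = (\<Sum>i\<in>e. lookup m i)"

lemma wt_add: "wt e (u + v) = wt e u + wt e v"
  by (simp add: wt_def lookup_add sum.distrib)

lemma wt_mono: "u \<preceq> v \<Longrightarrow> wt e u \<le> wt e v"
  by (auto simp: wt_def mle_def intro: sum_mono)

lemma up_closed_wt: "up_closed {m. k \<le> wt e m}"
  unfolding up_closed_def using wt_mono le_trans by blast

lemma ideal_gen_Var_wt:
  fixes e :: "'n::finite set"
  shows "ideal_gen (Var ` e) = mono_ideal {m. 1 \<le> wt e m}"
proof -
  have "(\<exists>i\<in>e. lookup m i \<noteq> 0) \<longleftrightarrow> 1 \<le> wt e m" for m
    by (simp add: wt_def Suc_le_eq flip: neq0_conv)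
  then show ?thesis
    by (simp add: ideal_gen_Var)
qed

text \<open>A weight that is generic on a finite set of exponents replaces a monomial order.\<close>

lemma generic_weight:
  fixes X :: "('n::finite \<Rightarrow>\<^sub>0 nat) set"
  assumes "finite X"
  shows "\<exists>\<phi> :: ('n \<Rightarrow>\<^sub>0 nat) \<Rightarrow> nat. inj_on \<phi> X \<and> (\<forall>u v. \<phi> (u + v) = \<phi> u + \<phi> v)"
proof -
  \<comment> \<open>\<open>B\<close> exceeds every exponent occurring in \<open>X\<close>, so
    \<open>\<phi>\<close> reads an exponent vector as the digits of a number in base
    \<open>B\<close>.\<close>
  define B where "B = Suc (\<Sum>u\<in>X. mdeg u)"
  obtain idx :: "'n \<Rightarrow> nat" where idx: "inj idx"
    using finite_imp_inj_to_nat_seg[of "UNIV :: 'n set"] by auto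
  define \<phi> where "\<phi> u = (\<Sum>i\<in>UNIV. lookup u i * B ^ idx i)" for u :: "'n \<Rightarrow>\<^sub>0 nat"
  have small: "lookup u i < B" if "u \<in> X" for u i
  proof -
    have "lookup u i \<le> mdeg u"
      unfolding mdeg_def by (rule member_le_sum) auto
    also have "\<dots> \<le> (\<Sum>u\<in>X. mdeg u)"
      using that assms by (intro member_le_sum) auto
    finally show ?thesis
      by (simp add: B_def)
  qed
  \<comment> \<open>Uniqueness of digits: the lowest position is recovered modulo \<open>B\<close>
    once its power of \<open>B\<close> is divided out; induction handles the others.\<close>
  have digits: "\<forall>i\<in>S. f i = g i"
    if "(\<Sum>i\<in>S. f i * B ^ idx i) = (\<Sum>i\<in>S. g i * B ^ idx i)"
      and "\<And>i. f i < B" "\<And>i. g i < B" for S and f g :: "'n \<Rightarrow> nat"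
    using finite[of S] that(1)
  proof (induction "card S" arbitrary: S)
    case 0
    then show ?case by simp
  next
    case (Suc n)
    define j where "j = arg_min_on idx S"
    have j: "j \<in> S" "\<And>i. i \<in> S \<Longrightarrow> i \<noteq> j \<Longrightarrow> idx j < idx i"
    proof -
      have "S \<noteq> {}" using Suc by auto
      then show "j \<in> S"
        unfolding j_def using arg_min_if_finite(1)[of S idx] by auto
      fix i assume i: "i \<in> S" "i \<noteq> j"
      have "\<not> idx i < idx j"
        unfolding j_def using arg_min_if_finite(2)[of S idx] \<open>S \<noteq> {}\<close> i by auto
      moreover have "idx i \<noteq> idx j"
        using idx i by (auto dest: injD)
      ultimately show "idx j < idx i"
        by simp
    qed
    have split: "\<exists>c. (\<Sum>i\<in>S. h i * B ^ idx i) = (h j + c * B) * B ^ idx j" for h :: "'n \<Rightarrow> nat"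
    proof -
      have "(\<Sum>i\<in>S - {j}. h i * B ^ idx i) = (\<Sum>i\<in>S - {j}. h i * B ^ (idx i - Suc (idx j))) * B * B ^ idx j"
        unfolding sum_distrib_right
      proof (intro sum.cong refl)
        fix i assume "i \<in> S - {j}"
        then have "idx i = idx i - Suc (idx j) + Suc (idx j)"
          using j(2)[of i] by simp
        then have "B ^ idx i = B ^ (idx i - Suc (idx j)) * (B * B ^ idx j)"
          by (metis power_Suc power_add)
        then show "h i * B ^ idx i = h i * B ^ (idx i - Suc (idx j)) * B * B ^ idx j"
          by simp
      qed
      then show ?thesis
        using j(1) by (auto simp: sum.remove[OF finite j(1)] algebra_simps)
    qed
    obtain c d where cd: "(\<Sum>i\<in>S. f i * B ^ idx i) = (f j + c * B) * B ^ idx j"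
      "(\<Sum>i\<in>S. g i * B ^ idx i) = (g j + d * B) * B ^ idx j"
      using split[of f] split[of g] by auto
    have "B > 0" by (simp add: B_def)
    then have "f j + c * B = g j + d * B"
      using Suc.prems cd by simp
    then have "(f j + c * B) mod B = (g j + d * B) mod B"
      by simp
    then have eq: "f j = g j"
      using that(2,3) by simp
    then have "(\<Sum>i\<in>S - {j}. f i * B ^ idx i) = (\<Sum>i\<in>S - {j}. g i * B ^ idx i)"
      using Suc.prems by (simp add: sum.remove[OF finite j(1)])
    moreover have "n = card (S - {j})"
      using Suc.hyps j(1) by simp
    ultimately have "\<forall>i\<in>S - {j}. f i = g i"
      by (intro Suc.hyps(1)) auto
    then show ?case
      using eq by blast
  qed
  have "inj_on \<phi> X"
  proof (rule inj_onI)
    fix u v assume "u \<in> X" "v \<in> X" "\<phi> u = \<phi> v"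
    then have "\<forall>i\<in>UNIV. lookup u i = lookup v i"
      by (intro digits small) (auto simp: \<phi>_def)
    then show "u = v"
      by (simp add: poly_mapping_eqI)
  qed
  moreover have "\<phi> (u + v) = \<phi> u + \<phi> v" for u v
    by (simp add: \<phi>_def lookup_add sum.distrib algebra_simps)
  ultimately show ?thesis
    by blast
qed

lemma finite_has_least_weight:
  fixes \<phi> :: "'a \<Rightarrow> nat"
  assumes "finite S" "S \<noteq> {}"
  shows "\<exists>u\<in>S. \<forall>v\<in>S. \<phi> u \<le> \<phi> v"
  using arg_min_if_finite(1)[OF assms, of \<phi>] arg_min_least[OF assms, of _ \<phi>] by blast

text \<open>The lowest form of \<open>s * f\<close> with respect to \<open>wt e\<close> is the product of the lowest forms.\<close>

lemma wt_ideal_primary: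
  fixes s f :: "('n::finite, 'k::field) mpoly"
  assumes s: "s \<notin> mono_ideal {m. 1 \<le> wt e m}" and sf: "s * f \<in> mono_ideal {m. k \<le> wt e m}"
  shows "f \<in> mono_ideal {m. k \<le> wt e m}"
proof (rule ccontr)
  assume f: "f \<notin> mono_ideal {m. k \<le> wt e m}"
  obtain \<phi> :: "('n \<Rightarrow>\<^sub>0 nat) \<Rightarrow> nat"
    where \<phi>: "inj_on \<phi> (keys s)" "\<And>u v. \<phi> (u + v) = \<phi> u + \<phi> v"
    using generic_weight[OF finite_keys[of s]] by blast
  define S where "S = {m \<in> keys s. wt e m = 0}"
  have "finite S" "S \<noteq> {}"
    using s by (auto simp: S_def mono_ideal_def)
  then obtain u0 where u0: "u0 \<in> S" "\<And>u. u \<in> S \<Longrightarrow> \<phi> u0 \<le> \<phi> u"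
    using finite_has_least_weight[of S \<phi>] by blast
  have "keys f \<noteq> {}"
    using f by (auto simp: mono_ideal_def)
  then obtain v1 where v1: "v1 \<in> keys f"
    "\<And>v. v \<in> keys f \<Longrightarrow> wt e v1 \<le> wt e v"
    using finite_has_least_weight[OF finite_keys, of f "wt e"] by blast
  define F where "F = {v \<in> keys f. wt e v = wt e v1}"
  have "finite F" "F \<noteq> {}"
    using v1 by (auto simp: F_def)
  then obtain v0 where v0: "v0 \<in> F" "\<And>v. v \<in> F \<Longrightarrow> \<phi> v0 \<le> \<phi> v"
    using finite_has_least_weight[of F \<phi>] by blast
  \<comment> \<open>No cancellation occurs at \<open>u0 + v0\<close>: weights add, so
    \<open>u\<close> and \<open>v\<close> both have lowest weight; values of \<open>\<phi>\<close>
    add, so both are also lowest for \<open>\<phi>\<close>. Since \<open>u\<close> determines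
    \<open>v\<close>, injectivity of \<open>\<phi>\<close> on \<open>keys s\<close> is
    enough.\<close>
  have unique: "u = u0" if u: "u \<in> keys s" and uv: "u + v = u0 + v0"
    and v: "v \<in> keys f" for u v
  proof -
    have "wt e u + wt e v = wt e u0 + wt e v0"
      using arg_cong[OF uv, of "wt e"] by (simp add: wt_add)
    moreover have "wt e v1 \<le> wt e v" "wt e v0 = wt e v1" "wt e u0 = 0"
      using v1 v v0 u0 by (auto simp: F_def S_def)
    ultimately have "u \<in> S" "v \<in> F"
      using u v by (auto simp: S_def F_def)
    then have "\<phi> u0 \<le> \<phi> u" "\<phi> v0 \<le> \<phi> v"
      using u0 v0 by auto
    moreover have "\<phi> u + \<phi> v = \<phi> u0 + \<phi> v0"
      using arg_cong[OF uv, of \<phi>] by (simp add: \<phi>(2))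
    ultimately have "\<phi> u = \<phi> u0"
      by linarith
    then show "u = u0"
      using \<phi>(1) u u0(1) by (auto simp: S_def inj_on_def)
  qed
  have "lookup (s * f) (u0 + v0) =
     (\<Sum>u\<in>keys s. if u = u0 then lookup s u * lookup f v0 else 0)"
    unfolding lookup_times
  proof (intro sum.cong refl)
    fix u assume u: "u \<in> keys s"
    show "(if u \<preceq> u0 + v0 then lookup s u * lookup f (u0 + v0 - u) else 0) =
        (if u = u0 then lookup s u * lookup f v0 else 0)"
      using unique[OF u, of "u0 + v0 - u"] by (auto simp: in_keys_iff)
  qed
  also have "\<dots> = lookup s u0 * lookup f v0"
    using u0 by (simp add: S_def)
  also have "\<dots> \<noteq> 0"
    using u0 v0 by (auto simp: S_def F_def in_keys_iff)
  finally have "k \<le> wt e (u0 + v0)"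
    using sf by (auto simp: mono_ideal_def in_keys_iff)
  moreover have "wt e (u0 + v0) = wt e v1"
    using u0 v0 by (auto simp: wt_add S_def F_def)
  moreover have "wt e v1 < k"
    using f v1(2) le_trans[of k "wt e v1"] by (force simp: mono_ideal_def not_le[symmetric])
  ultimately show False
    by simp
qed

section \<open>Minimal primes of the cover ideal\<close>

lemma prime_ideal_wt:
  "prime_ideal (mono_ideal {m. 1 \<le> wt e m} :: ('n::finite, 'k::field) mpoly set)"
  unfolding prime_ideal_def
proof (intro conjI allI impI)
  show "1 \<notin> (mono_ideal {m. 1 \<le> wt e m} :: ('n, 'k) mpoly set)"
    by (simp add: mono_ideal_def wt_def)
next
  fix a b :: "('n, 'k) mpoly"
  assume "a * b \<in> mono_ideal {m. 1 \<le> wt e m}"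
  then show "a \<in> mono_ideal {m. 1 \<le> wt e m} \<or> b \<in> mono_ideal {m. 1 \<le> wt e m}"
    using wt_ideal_primary[of a e b 1] by blast
qed (rule is_ideal_mono_ideal[OF up_closed_wt])

lemma prime_ideal_prodD:
  assumes "prime_ideal P" "finite S" "(\<Prod>x\<in>S. f x) \<in> P"
  shows "\<exists>x\<in>S. f x \<in> P"
  using assms(2,3)
proof (induction S)
  case empty
  then show ?case
    using assms(1) by (simp add: prime_ideal_def)
next
  case (insert x S)
  then have "f x \<in> P \<or> prod f S \<in> P"
    using assms(1) by (auto simp: prime_ideal_def)
  then show ?case
    using insert.IH by blast
qed

lemma wt_ideal_subset_iff:
  "(mono_ideal {m. 1 \<le> wt e m} :: ('n::finite, 'k::field) mpoly set)
     \<subseteq> mono_ideal {m. 1 \<le> wt e' m} \<longleftrightarrow> e \<subseteq> e'"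
proof
  assume *: "(mono_ideal {m. 1 \<le> wt e m} :: ('n, 'k) mpoly set) \<subseteq> mono_ideal {m. 1 \<le> wt e' m}"
  show "e \<subseteq> e'"
  proof
    fix i assume "i \<in> e"
    then have "single (single i (Suc 0)) 1 \<in> (mono_ideal {m. 1 \<le> wt e m} :: ('n, 'k) mpoly set)"
      by (simp add: wt_def)
    then have "single (single i (Suc 0)) 1 \<in> (mono_ideal {m. 1 \<le> wt e' m} :: ('n, 'k) mpoly set)"
      using * by blast
    then show "i \<in> e'"
      by (simp add: wt_def split: if_splits)
  qed
next
  assume "e \<subseteq> e'"
  then have "wt e m \<le> wt e' m" for m
    unfolding wt_def by (intro sum_mono2) auto
  then show "(mono_ideal {m. 1 \<le> wt e m} :: ('n, 'k) mpoly set) \<subseteq> mono_ideal {m. 1 \<le> wt e' m}"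
    unfolding mono_ideal_def by (auto dest!: subsetD intro: le_trans)
qed

lemma cover_ideal_eq:
  "cover_ideal E = (\<Inter>e\<in>E. mono_ideal {m. 1 \<le> wt e m} :: ('n::finite, 'k::field) mpoly set)"
  by (simp only: cover_ideal_def ideal_gen_Var_wt)

lemma simple_graph_subset_eq:
  fixes E :: "'n::finite set set"
  assumes "simple_graph E" "e \<in> E" "e' \<in> E" "e' \<subseteq> e"
  shows "e' = e"
  using assms by (intro card_subset_eq) (auto simp: simple_graph_def)

text \<open>Otherwise each edge prime has an element outside \<open>P\<close>. The product of these
  lies in every edge prime, hence in \<open>P\<close>, against primality.\<close>

lemma prime_over_cover_ideal:
  fixes E :: "'n::finite set set" and P :: "('n, 'k::field) mpoly set"
  assumes P: "prime_ideal P" and sub: "cover_ideal E \<subseteq> P"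
  shows "\<exists>e\<in>E. mono_ideal {m. 1 \<le> wt e m} \<subseteq> P"
proof (rule ccontr)
  assume "\<not> ?thesis"
  then have "\<forall>e\<in>E. \<exists>f. f \<in> mono_ideal {m. 1 \<le> wt e m} \<and> f \<notin> P"
    by blast
  then obtain f where f: "\<And>e. e \<in> E \<Longrightarrow> f e \<in> mono_ideal {m. 1 \<le> wt e m}" "\<And>e. e \<in> E \<Longrightarrow> f e \<notin> P"
    by metis
  have "(\<Prod>e\<in>E. f e) \<in> mono_ideal {m. 1 \<le> wt e m}" if "e \<in> E" for e
  proof -
    have "(\<Prod>e\<in>E. f e) = (\<Prod>e\<in>E - {e}. f e) * f e"
      using that by (simp add: prod.remove[of E e] mult.commute)
    then show ?thesis
      using ring_as_module.subspace_scale[OF is_ideal_mono_ideal[OF up_closed_wt] f(1)[OF that]]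
      by simp
  qed
  then have "(\<Prod>e\<in>E. f e) \<in> cover_ideal E"
    by (simp add: cover_ideal_eq)
  then show False
    using prime_ideal_prodD[OF P, of E f] sub f(2) by auto
qed

text \<open>By \<open>prime_over_cover_ideal\<close> every prime over the cover ideal contains an
  edge prime, and edge primes are pairwise incomparable because all edges have two elements.\<close>

lemma Min_primes_cover_ideal:
  fixes E :: "'n::finite set set"
  assumes E: "simple_graph E"
  shows "Min_primes (cover_ideal E :: ('n, 'k::field) mpoly set) =
    (\<lambda>e. mono_ideal {m. 1 \<le> wt e m}) ` E"
proof (intro equalityI subsetI)
  fix P :: "('n, 'k) mpoly set"
  assume "P \<in> Min_primes (cover_ideal E)"
  then have P: "prime_ideal P" "cover_ideal E \<subseteq> P"
    and min: "\<And>Q. prime_ideal Q \<Longrightarrow> cover_ideal E \<subseteq> Q \<Longrightarrow> Q \<subseteq> P \<Longrightarrow> Q = P"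
    by (auto simp: Min_primes_def)
  obtain e where e: "e \<in> E" "mono_ideal {m. 1 \<le> wt e m} \<subseteq> P"
    using prime_over_cover_ideal[OF P] by blast
  moreover have "cover_ideal E \<subseteq> (mono_ideal {m. 1 \<le> wt e m} :: ('n, 'k) mpoly set)"
    using e(1) by (auto simp: cover_ideal_eq)
  ultimately have "mono_ideal {m. 1 \<le> wt e m} = P"
    by (intro min prime_ideal_wt)
  then show "P \<in> (\<lambda>e. mono_ideal {m. 1 \<le> wt e m}) ` E"
    using e(1) by blast
next
  fix P :: "('n, 'k) mpoly set"
  assume "P \<in> (\<lambda>e. mono_ideal {m. 1 \<le> wt e m}) ` E"
  then obtain e where e: "e \<in> E" and P: "P = mono_ideal {m. 1 \<le> wt e m}"
    by blast
  have "Q = P" if Q: "prime_ideal Q" "cover_ideal E \<subseteq> Q" "Q \<subseteq> P" for Q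
  proof -
    obtain e' where e': "e' \<in> E" "mono_ideal {m. 1 \<le> wt e' m} \<subseteq> Q"
      using prime_over_cover_ideal[OF Q(1,2)] by blast
    then have "(mono_ideal {m. 1 \<le> wt e' m} :: ('n, 'k) mpoly set) \<subseteq> mono_ideal {m. 1 \<le> wt e m}"
      using Q(3) P by blast
    then have "e' = e"
      using simple_graph_subset_eq[OF E e e'(1)] by (simp only: wt_ideal_subset_iff)
    then show ?thesis
      using e'(2) Q(3) P by blast
  qed
  moreover have "cover_ideal E \<subseteq> P"
    using e P by (auto simp: cover_ideal_eq)
  ultimately show "P \<in> Min_primes (cover_ideal E)"
    using prime_ideal_wt P by (auto simp: Min_primes_def)
qed

section \<open>Powers of the cover ideal and their localizations at edge primes\<close>

lemma is_ideal_power: "is_ideal (ideal_power I k)"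
  by (cases k) (simp_all add: ring_as_module.subspace_UNIV ideal_prod_def ring_as_module.subspace_span)

lemma ideal_power_cover_subset:
  assumes "e \<in> E"
  shows "ideal_power (cover_ideal E) k \<subseteq> (mono_ideal {m. k \<le> wt e m} :: ('n::finite, 'k::field) mpoly set)"
proof (induction k)
  case 0
  then show ?case by (simp add: mono_ideal_def)
next
  case (Suc k)
  have "a * b \<in> mono_ideal {m. Suc k \<le> wt e m}"
    if "a \<in> cover_ideal E" "b \<in> ideal_power (cover_ideal E) k" for a b :: "('n, 'k) mpoly"
  proof -
    have "a \<in> mono_ideal {m. 1 \<le> wt e m}" "b \<in> mono_ideal {m. k \<le> wt e m}"
      using that assms Suc.IH by (auto simp: cover_ideal_eq)
    then show ?thesis
      by (fastforce simp: mono_ideal_def wt_add elim!: keys_timesE)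
  qed
  then show ?case
    unfolding ideal_power.simps ideal_prod_def
    by (intro ring_as_module.span_minimal is_ideal_mono_ideal up_closed_wt) blast
qed

text \<open>Each induction step splits off a vertex cover that meets \<open>e\<close> in one vertex
  \<open>i\<close> still present in \<open>m\<close> and contains everything outside
  \<open>e\<close>. It covers every other edge, as no other edge lies inside \<open>e\<close>. The
  exponents outside \<open>e\<close> must pay for all \<open>k\<close> covers.\<close>

lemma single_in_ideal_power_cover:
  fixes E :: "'n::finite set set"
  assumes E: "simple_graph E" and e: "e \<in> E"
  shows "k \<le> wt e m \<Longrightarrow> (\<And>l. l \<notin> e \<Longrightarrow> k \<le> lookup m l) \<Longrightarrow>
    single m 1 \<in> (ideal_power (cover_ideal E) k :: ('n, 'k::field) mpoly set)"
proof (induction k arbitrary: m)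
  case 0
  then show ?case by simp
next
  case (Suc k)
  then have "wt e m \<noteq> 0"
    by linarith
  then have "(\<Sum>i\<in>e. lookup m i) \<noteq> 0"
    by (simp only: wt_def not_False_eq_True)
  then obtain i where i: "i \<in> e" "lookup m i \<noteq> 0"
    by auto
  define u where "u = mk (\<lambda>l. if l = i \<or> l \<notin> e then 1 else 0)"
  have "wt e u = (\<Sum>l\<in>e. if l = i then 1 else 0)"
    unfolding wt_def u_def by (intro sum.cong) auto
  then have wt_u: "wt e u = 1"
    using i(1) by simp
  have "u \<preceq> m"
    using i Suc.prems(2) by (fastforce simp: mle_def u_def)
  then have m: "m = u + (m - u)"
    by simp
  have "1 \<le> wt e' u" if "e' \<in> E" for e'
  proof (cases "e' = e")
    case False
    then have "\<not> e' \<subseteq> e"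
      using simple_graph_subset_eq[OF E e that] by blast
    then obtain l where "l \<in> e'" "l \<notin> e"
      by blast
    moreover have "lookup u l \<le> wt e' u"
      unfolding wt_def using \<open>l \<in> e'\<close> by (intro member_le_sum) auto
    ultimately show ?thesis
      by (simp add: u_def)
  qed (simp add: wt_u)
  then have "single u 1 \<in> (cover_ideal E :: ('n, 'k) mpoly set)"
    by (simp add: cover_ideal_eq)
  moreover have "single (m - u) 1 \<in> (ideal_power (cover_ideal E) k :: ('n, 'k) mpoly set)"
  proof (rule Suc.IH)
    have "wt e m = wt e u + wt e (m - u)"
      by (metis m wt_add)
    then show "k \<le> wt e (m - u)"
      using Suc.prems(1) wt_u by simp
    show "k \<le> lookup (m - u) l" if "l \<notin> e" for l
      using Suc.prems(2)[OF that] by (auto simp: lookup_minus u_def)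
  qed
  ultimately have "single u 1 * single (m - u) 1 \<in> (ideal_power (cover_ideal E) (Suc k) :: ('n, 'k) mpoly set)"
    unfolding ideal_power.simps ideal_prod_def by (blast intro: ring_as_module.span_base)
  moreover have "single u 1 * single (m - u) 1 = single m (1 :: 'k)"
    using m by (simp add: mult_single)
  ultimately show ?case
    by simp
qed

lemma local_contraction_cover:
  fixes E :: "'n::finite set set"
  assumes E: "simple_graph E" and e: "e \<in> E"
  shows "local_contraction (ideal_power (cover_ideal E) k) (mono_ideal {m. 1 \<le> wt e m}) =
    (mono_ideal {m. k \<le> wt e m} :: ('n, 'k::field) mpoly set)" (is "?L = ?R")
proof
  show "?L \<subseteq> ?R"
    using ideal_power_cover_subset[OF e, where 'k='k and k=k] wt_ideal_primary[where k=k]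
    by (fastforce simp: local_contraction_def)
next
  \<comment> \<open>\<open>x^s0\<close> involves only variables outside \<open>e\<close>, which are
    units at the edge prime; the exponent \<open>k\<close> supplies what
    \<open>single_in_ideal_power_cover\<close> asks for outside \<open>e\<close>.\<close>
  define s0 :: "'n \<Rightarrow>\<^sub>0 nat" where "s0 = mk (\<lambda>l. if l \<in> e then 0 else k)"
  define s where "s = single s0 (1 :: 'k)"
  define I where "I = (ideal_power (cover_ideal E) k :: ('n, 'k) mpoly set)"
  have "wt e s0 = 0"
    by (simp add: wt_def s0_def)
  then have s: "s \<notin> mono_ideal {m. 1 \<le> wt e m}"
    by (simp add: s_def)
  have I: "is_ideal I"
    unfolding I_def by (rule is_ideal_power)
  have "is_ideal {f. s * f \<in> I}"
  proof (rule ring_as_module.subspaceI)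
    fix c f :: "('n, 'k) mpoly"
    assume "f \<in> {f. s * f \<in> I}"
    then have "s * f \<in> I"
      by blast
    then have "c * (s * f) \<in> I"
      by (rule ring_as_module.subspace_scale[OF I])
    then have "s * (c * f) \<in> I"
      by (simp only: mult.left_commute)
    then show "c * f \<in> {f. s * f \<in> I}"
      by blast
  qed (use ring_as_module.subspace_add[OF I] ring_as_module.subspace_0[OF I] in
      \<open>auto simp: distrib_left\<close>)
  moreover have "single m 1 \<in> {f. s * f \<in> I}" if "m \<in> {m. k \<le> wt e m}" for m
  proof -
    have "single (s0 + m) 1 \<in> I"
      unfolding I_def using that
      by (intro single_in_ideal_power_cover[OF E e]) (auto simp: wt_add lookup_add s0_def)
    then show ?thesis
      by (simp add: s_def mult_single)
  qed
  ultimately have "mono_ideal {m. k \<le> wt e m} \<subseteq> {f. s * f \<in> I}"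
    by (rule mono_ideal_subset_ideal)
  then show "?R \<subseteq> ?L"
    using s by (auto simp: local_contraction_def I_def)
qed

lemma symbolic_power_cover_ideal:
  fixes E :: "'n::finite set set"
  assumes E: "simple_graph E"
  shows "symbolic_power (cover_ideal E) k =
    (mono_ideal {m. \<forall>e\<in>E. k \<le> wt e m} :: ('n, 'k::field) mpoly set)"
proof -
  have "symbolic_power (cover_ideal E) k =
      (\<Inter>e\<in>E. mono_ideal {m. k \<le> wt e m} :: ('n, 'k::field) mpoly set)"
    unfolding symbolic_power_def Min_primes_cover_ideal[OF E]
    unfolding image_image by (intro INF_cong refl local_contraction_cover[OF E])
  then show ?thesis
    by (auto simp: mono_ideal_def)
qed

section \<open>A lower bound on the degrees of first syzygies\<close>

text \<open>This truncation does not commute with multiplication by polynomials. If it did, the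
  functional built from it in \<open>second_syzygy_degree\<close> would vanish on every
  syzygy.\<close>

definition restrict_above :: "('n \<Rightarrow>\<^sub>0 nat) \<Rightarrow> ('n, 'k::field) mpoly \<Rightarrow> ('n, 'k) mpoly"
  where "restrict_above g f = (\<Sum>u | u \<in> keys f \<and> g \<preceq> u. single u (lookup f u))"

lemma lookup_restrict_above:
  "lookup (restrict_above g f) u = (if g \<preceq> u then lookup f u else 0)"
  by (auto simp: restrict_above_def lookup_sum lookup_single when_def in_keys_iff sum.delta)

text \<open>The coefficient of a product at \<open>\<beta>\<close> sees only terms of
  \<open>f\<close> whose exponents are below \<open>\<beta>\<close>. Truncation keeps all of them in
  the first case and deletes all of them in the second.\<close>

lemma lookup_times_restrict_above:
  assumes "keys f \<subseteq> M"
  shows "\<forall>u\<in>M. u \<preceq> \<beta> \<longrightarrow> g \<preceq> u \<Longrightarrow> lookup (p * restrict_above g f) \<beta> = lookup (p * f) \<beta>"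
    and "\<forall>u\<in>M. u \<preceq> \<beta> \<longrightarrow> \<not> g \<preceq> u \<Longrightarrow> lookup (p * restrict_above g f) \<beta> = 0"
proof -
  assume *: "\<forall>u\<in>M. u \<preceq> \<beta> \<longrightarrow> g \<preceq> u"
  show "lookup (p * restrict_above g f) \<beta> = lookup (p * f) \<beta>"
    unfolding lookup_times
  proof (intro sum.cong refl)
    fix m
    have "lookup (restrict_above g f) (\<beta> - m) = lookup f (\<beta> - m)"
    proof (cases "\<beta> - m \<in> M")
      case True
      then show ?thesis
        using * by (simp add: lookup_restrict_above)
    next
      case False
      then have "\<beta> - m \<notin> keys f"
        using assms by blast
      then show ?thesis
        by (simp add: lookup_restrict_above in_keys_iff)
    qed
    then show "(if m \<preceq> \<beta> then lookup p m * lookup (restrict_above g f) (\<beta> - m) else 0) =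
        (if m \<preceq> \<beta> then lookup p m * lookup f (\<beta> - m) else 0)"
      by simp
  qed
next
  assume *: "\<forall>u\<in>M. u \<preceq> \<beta> \<longrightarrow> \<not> g \<preceq> u"
  show "lookup (p * restrict_above g f) \<beta> = 0"
    unfolding lookup_times
  proof (intro sum.neutral ballI)
    fix m
    have "lookup (restrict_above g f) (\<beta> - m) = 0"
    proof (cases "\<beta> - m \<in> M")
      case True
      then show ?thesis
        using * by (simp add: lookup_restrict_above)
    next
      case False
      then have "\<beta> - m \<notin> keys f"
        using assms by blast
      then show ?thesis
        by (simp add: lookup_restrict_above in_keys_iff)
    qed
    then show "(if m \<preceq> \<beta> then lookup p m * lookup (restrict_above g f) (\<beta> - m) else 0) = 0"
      by simp
  qed
qed

lemma index_mult_mat_vec_sum: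
  assumes "B \<in> carrier_mat r n" "v \<in> carrier_vec n" "i < r"
  shows "(B *\<^sub>v v) $ i = (\<Sum>j<n. B $$ (i, j) * v $ j)"
  using assms by (auto simp: scalar_prod_def lessThan_atLeast0 intro!: sum.cong)

lemma mult_mat_unit_vec:
  fixes B :: "'a::comm_ring_1 mat"
  assumes "B \<in> carrier_mat r n" "j < n"
  shows "B *\<^sub>v unit_vec n j = col B j"
  using assms by (intro eq_vecI) (auto simp: scalar_prod_right_unit)

text \<open>The last clause says that \<open>g1\<close> and \<open>g2\<close> are not linked through
  monomials of \<open>M\<close> strictly below \<open>b\<close>. For up-closed \<open>M\<close> it
  makes the upper Koszul complex at \<open>b\<close> disconnected, the classical criterion for a
  first syzygy in multidegree \<open>b\<close>.\<close>

definition critical ::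
  "('n \<Rightarrow>\<^sub>0 nat) set \<Rightarrow> ('n \<Rightarrow>\<^sub>0 nat) \<Rightarrow> ('n \<Rightarrow>\<^sub>0 nat) \<Rightarrow> ('n \<Rightarrow>\<^sub>0 nat) \<Rightarrow> bool"
where
  "critical M b g1 g2 \<longleftrightarrow>
     g1 \<in> M \<and> g1 \<preceq> b \<and> g2 \<in> M \<and> g2 \<preceq> b \<and> \<not> g1 \<preceq> g2 \<and>
     (\<forall>u\<in>M. u \<preceq> g1 \<longrightarrow> g1 \<preceq> u) \<and>
     (\<forall>\<beta>. \<beta> \<preceq> b \<longrightarrow> \<beta> \<noteq> b \<longrightarrow>
        (\<forall>u\<in>M. u \<preceq> \<beta> \<longrightarrow> g1 \<preceq> u) \<or> (\<forall>u\<in>M. u \<preceq> \<beta> \<longrightarrow> \<not> g1 \<preceq> u))"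

text \<open>The coefficient of \<open>b\<close> in \<open>\<Sum>\<^sub>c s\<^sub>c h\<^sub>c'\<close>, where \<open>h\<^sub>c'\<close> is the part of the \<open>c\<close>-th generator
  above \<open>g1\<close>, is a linear functional on syzygies that kills the multiples of syzygies by
  monomials other than \<open>1\<close>, but not the syzygy between \<open>g1\<close> and \<open>g2\<close>.\<close>

lemma second_syzygy_degree:
  fixes M :: "('n::finite \<Rightarrow>\<^sub>0 nat) set"
    and A :: "nat \<Rightarrow> ('n, 'k::field) mpoly mat"
  assumes res: "min_graded_free_resolution (mono_ideal M) D A"
    and crit: "critical M b g1 g2"
  shows "mdeg b \<in> set (D 2)"
proof -
  have g1: "g1 \<in> M" "g1 \<preceq> b" and g2: "g2 \<in> M" "g2 \<preceq> b" and "\<not> g1 \<preceq> g2"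
    using crit by (simp_all add: critical_def)
  have minimal: "g1 \<preceq> u" if "u \<in> M" "u \<preceq> g1" for u
    using crit that by (simp add: critical_def)
  have split: "(\<forall>u\<in>M. u \<preceq> \<beta> \<longrightarrow> g1 \<preceq> u) \<or> (\<forall>u\<in>M. u \<preceq> \<beta> \<longrightarrow> \<not> g1 \<preceq> u)"
    if "\<beta> \<preceq> b" "\<beta> \<noteq> b" for \<beta>
    using crit that unfolding critical_def by blast
  define n1 n2 where "n1 = length (D 1)" and "n2 = length (D 2)"
  define h where "h c = A 0 $$ (0, c)" for c
  define Q where "Q s = (\<Sum>c<n1. s c * restrict_above g1 (h c))" for s :: "nat \<Rightarrow> ('n, 'k) mpoly"
  have D0: "D 0 = [0]"
    using res by (simp add: min_graded_free_resolution_def)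
  have "\<forall>i. A i \<in> carrier_mat (length (D i)) (length (D (Suc i)))"
    using res by (simp add: min_graded_free_resolution_def)
  from this[rule_format, of 0] this[rule_format, of 1]
  have A0: "A 0 \<in> carrier_mat 1 n1" and A1: "A 1 \<in> carrier_mat n1 n2"
    by (simp_all add: D0 n1_def n2_def numeral_2_eq_2)
  have deg: "mdeg m + D i ! r = D (Suc i) ! c"
    if "r < length (D i)" "c < length (D (Suc i))" "m \<in> keys (A i $$ (r, c))" for i r c m
    using res that unfolding min_graded_free_resolution_def by blast
  have image: "{(A 0 *\<^sub>v v) $ 0 | v. v \<in> carrier_vec n1} = mono_ideal M"
    using res by (simp add: min_graded_free_resolution_def n1_def)
  have ker: "mat_kernel (A 0) = {A 1 *\<^sub>v v | v. v \<in> carrier_vec n2}"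
    using res by (simp add: min_graded_free_resolution_def n2_def numeral_2_eq_2)
  have A0_mult: "(A 0 *\<^sub>v v) $ 0 = (\<Sum>c<n1. v $ c * h c)" if "v \<in> carrier_vec n1" for v
    using index_mult_mat_vec_sum[OF A0 that, of 0] by (simp add: h_def mult.commute)
  have h_M: "keys (h c) \<subseteq> M" if "c < n1" for c
  proof -
    have "h c = (A 0 *\<^sub>v unit_vec n1 c) $ 0"
      using A0 that by (simp add: mult_mat_unit_vec h_def)
    then have "h c \<in> mono_ideal M"
      unfolding image[symmetric] by auto
    then show ?thesis
      by (simp add: mono_ideal_def)
  qed
  have Q_all: "lookup (Q s) \<beta> = lookup (\<Sum>c<n1. s c * h c) \<beta>"
    if "\<forall>u\<in>M. u \<preceq> \<beta> \<longrightarrow> g1 \<preceq> u" for s \<beta>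
    unfolding Q_def lookup_sum
    by (intro sum.cong refl lookup_times_restrict_above(1)[OF h_M that]) simp
  have Q_none: "lookup (Q s) \<beta> = 0"
    if "\<forall>u\<in>M. u \<preceq> \<beta> \<longrightarrow> \<not> g1 \<preceq> u" for s \<beta>
    unfolding Q_def lookup_sum
    by (intro sum.neutral ballI lookup_times_restrict_above(2)[OF h_M that]) simp
  \<comment> \<open>Properly below \<open>b\<close> the truncation keeps either the whole relation,
    whose value is 0, or nothing.\<close>
  have Q_ker: "lookup (Q (($) s)) \<beta> = 0" if "s \<in> mat_kernel (A 0)" "\<beta> \<preceq> b" "\<beta> \<noteq> b" for s \<beta>
  proof -
    have "s \<in> carrier_vec n1" "A 0 *\<^sub>v s = 0\<^sub>v 1"
      using mat_kernelD[OF A0 that(1)] by auto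
    then have "(\<Sum>c<n1. s $ c * h c) = 0"
      using A0_mult[of s] by simp
    then show ?thesis
      using split[OF that(2,3)] Q_all Q_none by fastforce
  qed
  have generate: "\<exists>p. p \<in> carrier_vec n1 \<and> (\<Sum>c<n1. p $ c * h c) = single g 1" if "g \<in> M" for g
  proof -
    have "single g 1 \<in> {(A 0 *\<^sub>v v) $ 0 | v. v \<in> carrier_vec n1}"
      unfolding image using that by simp
    then show ?thesis
      using A0_mult by fastforce
  qed
  obtain p where p: "p \<in> carrier_vec n1" "(\<Sum>c<n1. p $ c * h c) = single g1 1"
    using generate[OF g1(1)] by blast
  obtain q where q: "q \<in> carrier_vec n1" "(\<Sum>c<n1. q $ c * h c) = single g2 1"
    using generate[OF g2(1)] by blast
  \<comment> \<open>The generators \<open>h\<close> need not be monomials, so the syzygy between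
    \<open>x^g1\<close> and \<open>x^g2\<close> is lifted through expressions \<open>p\<close> and
    \<open>q\<close> of these monomials in terms of \<open>h\<close>.\<close>
  define x1 x2 where "x1 = single (b - g1) (1 :: 'k)" and "x2 = single (b - g2) (1 :: 'k)"
  define s where "s = vec n1 (\<lambda>c. x1 * p $ c - x2 * q $ c)"
  have lin: "(\<Sum>c<n1. s $ c * f c) = x1 * (\<Sum>c<n1. p $ c * f c) - x2 * (\<Sum>c<n1. q $ c * f c)" for f
  proof -
    have "(\<Sum>c<n1. s $ c * f c) = (\<Sum>c<n1. x1 * (p $ c * f c) - x2 * (q $ c * f c))"
    proof (rule sum.cong[OF refl])
      fix c assume "c \<in> {..<n1}"
      then have 1: "s $ c = x1 * p $ c - x2 * q $ c"
        unfolding s_def by simp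
      show "s $ c * f c = x1 * (p $ c * f c) - x2 * (q $ c * f c)"
        unfolding 1 left_diff_distrib by (simp only: mult.assoc)
    qed
    then show ?thesis
      unfolding sum_subtractf sum_distrib_left .
  qed
  have s: "s \<in> carrier_vec n1"
    by (simp add: s_def)
  have "(\<Sum>c<n1. s $ c * h c) = 0"
    unfolding lin p(2) q(2) x1_def x2_def mult_single using g1(2) g2(2) by simp
  then have "(A 0 *\<^sub>v s) $ 0 = 0"
    using A0_mult[OF s] by simp
  then have "A 0 *\<^sub>v s = 0\<^sub>v 1"
    using A0 by (intro eq_vecI) auto
  then have "s \<in> mat_kernel (A 0)"
    by (intro mat_kernelI[OF A0 s])
  then obtain w where w: "w \<in> carrier_vec n2" "s = A 1 *\<^sub>v w"
    unfolding ker by blast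
  \<comment> \<open>At \<open>b\<close> the \<open>x1\<close> part contributes the coefficient of
    \<open>Q p\<close> at \<open>g1\<close>, untouched by truncation as \<open>g1\<close> is
    minimal; the \<open>x2\<close> part contributes that of \<open>Q q\<close> at \<open>g2\<close>,
    where no exponent below \<open>g2\<close> is above \<open>g1\<close>.\<close>
  have "lookup (Q (($) p)) g1 = 1"
    using Q_all[of g1 "($) p"] minimal p(2) by simp
  moreover have "lookup (Q (($) q)) g2 = 0"
    using \<open>\<not> g1 \<preceq> g2\<close> by (intro Q_none) (blast dest: mle_trans)
  moreover have "b - (b - g1) = g1" "b - (b - g2) = g2"
    using g1(2) g2(2) add_diff_cancel_right'[of g1 "b - g1"] add_diff_cancel_right'[of g2 "b - g2"]
    by simp_all
  moreover have "Q (($) s) = x1 * Q (($) p) - x2 * Q (($) q)"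
    unfolding Q_def by (rule lin)
  ultimately have nonzero: "lookup (Q (($) s)) b = 1"
    by (simp add: lookup_minus x1_def x2_def lookup_single_times)
  have "Q (($) s) = (\<Sum>c<n1. \<Sum>j<n2. w $ j * (A 1 $$ (c, j) * restrict_above g1 (h c)))"
    unfolding Q_def w(2)
  proof (intro sum.cong refl)
    fix c assume "c \<in> {..<n1}"
    then have "(A 1 *\<^sub>v w) $ c = (\<Sum>j<n2. A 1 $$ (c, j) * w $ j)"
      by (intro index_mult_mat_vec_sum[OF A1 w(1)]) simp
    then show "(A 1 *\<^sub>v w) $ c * restrict_above g1 (h c) =
        (\<Sum>j<n2. w $ j * (A 1 $$ (c, j) * restrict_above g1 (h c)))"
      by (simp only: sum_distrib_right) (simp only: ac_simps)
  qed
  also have "\<dots> = (\<Sum>j<n2. w $ j * Q (\<lambda>c. A 1 $$ (c, j)))"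
    unfolding Q_def sum_distrib_left by (rule sum.swap)
  finally have "lookup (\<Sum>j<n2. w $ j * Q (\<lambda>c. A 1 $$ (c, j))) b \<noteq> 0"
    using nonzero by simp
  then obtain j where j: "j < n2" "lookup (w $ j * Q (\<lambda>c. A 1 $$ (c, j))) b \<noteq> 0"
    unfolding lookup_sum by (metis (no_types, lifting) lessThan_iff sum.neutral)
  \<comment> \<open>The coefficients of \<open>R\<close> vanish at all proper divisors of
    \<open>b\<close>, so only the constant term of \<open>w $ j\<close> can contribute at
    \<open>b\<close>, and \<open>R\<close> itself must be nonzero there.\<close>
  define R where "R = Q (\<lambda>c. A 1 $$ (c, j))"
  have R_zero: "lookup R \<beta> = 0" if "\<beta> \<preceq> b" "\<beta> \<noteq> b" for \<beta>
  proof -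
    have "A 1 *\<^sub>v unit_vec n2 j \<in> mat_kernel (A 0)"
      unfolding ker by auto
    then have "col (A 1) j \<in> mat_kernel (A 0)"
      using A1 j(1) by (simp add: mult_mat_unit_vec)
    from Q_ker[OF this that] have "lookup (Q (($) (col (A 1) j))) \<beta> = 0" .
    moreover have "Q (($) (col (A 1) j)) = R"
      unfolding R_def Q_def using A1 j(1) by (intro sum.cong) auto
    ultimately show ?thesis
      by simp
  qed
  have "lookup R b \<noteq> 0"
  proof
    assume "lookup R b = 0"
    then have "lookup R (b - m) = 0" for m
      by (cases "b - m = b") (auto intro: R_zero)
    then have "lookup (w $ j * R) b = 0"
      by (simp add: lookup_times sum.neutral)
    then show False
      using j(2) by (simp add: R_def)
  qed
  \<comment> \<open>Homogeneity fixes the total degrees of the two factors of any term contributing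
    to \<open>x^b\<close>; this identifies the shift of column \<open>j\<close> as
    \<open>mdeg b\<close>.\<close>
  then obtain c where c: "c < n1" "lookup (A 1 $$ (c, j) * restrict_above g1 (h c)) b \<noteq> 0"
    unfolding R_def Q_def lookup_sum by (metis (no_types, lifting) lessThan_iff sum.neutral)
  then obtain u v where uv: "u \<in> keys (A 1 $$ (c, j))" "v \<in> keys (restrict_above g1 (h c))" "b = u + v"
    by (meson in_keys_iff keys_timesE)
  then have "v \<in> keys (h c)"
    by (auto simp: in_keys_iff lookup_restrict_above split: if_splits)
  then have "mdeg v = D 1 ! c"
    using deg[of 0 0 c v] c(1) by (simp add: D0 h_def n1_def)
  moreover have "mdeg u + D 1 ! c = D 2 ! j"
    using deg[of c 1 j u] c(1) j(1) uv(1) by (simp add: n1_def n2_def numeral_2_eq_2)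
  ultimately have "mdeg b = D 2 ! j"
    by (simp add: uv(3) mdeg_add)
  then show ?thesis
    using j(1) by (simp add: n2_def)
qed

section \<open>A critical multidegree\<close>

definition upd :: "('n::finite \<Rightarrow>\<^sub>0 nat) \<Rightarrow> 'n \<Rightarrow> nat \<Rightarrow> 'n \<Rightarrow>\<^sub>0 nat"
  where "upd u i x = mk ((lookup u)(i := x))"

lemma lookup_upd: "lookup (upd u i x) j = (if j = i then x else lookup u j)"
  by (simp add: upd_def)

definition edge_ge :: "('n \<Rightarrow> 'n \<Rightarrow> bool) \<Rightarrow> nat \<Rightarrow> ('n \<Rightarrow>\<^sub>0 nat) set"
  where "edge_ge adj k = {u. \<forall>i j. adj i j \<longrightarrow> k \<le> lookup u i + lookup u j}"

lemma edge_geD: "u \<in> edge_ge adj k \<Longrightarrow> adj i j \<Longrightarrow> k \<le> lookup u i + lookup u j"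
  by (simp add: edge_ge_def)

lemma up_closed_edge_ge: "up_closed (edge_ge adj k)"
  unfolding up_closed_def
proof (intro ballI allI impI)
  fix u v :: "'a \<Rightarrow>\<^sub>0 nat"
  assume u: "u \<in> edge_ge adj k" and uv: "u \<preceq> v"
  show "v \<in> edge_ge adj k"
    unfolding edge_ge_def
  proof (intro CollectI allI impI)
    fix i j assume "adj i j"
    then show "k \<le> lookup v i + lookup v j"
      using edge_geD[OF u, of i j] mleD[OF uv, of i] mleD[OF uv, of j] by linarith
  qed
qed

definition least_mle :: "('n \<Rightarrow>\<^sub>0 nat) set \<Rightarrow> ('n \<Rightarrow>\<^sub>0 nat) \<Rightarrow> bool"
  where "least_mle U m \<longleftrightarrow> m \<in> U \<and> (\<forall>u\<in>U. m \<preceq> u)"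

text \<open>Take \<open>a\<close> minimal such that the exponents in \<open>M\<close> below \<open>a\<close> have no least element, and let
  \<open>m\<close> be their infimum. Then \<open>a - m\<close> is a \<open>0\<close>-\<open>1\<close>-vector, and on its support the edges
  \<open>{i, j}\<close> with \<open>m\<^sub>i + m\<^sub>j < k\<close> form a complete multipartite graph, whose parts
  correspond to the minimal elements of \<open>M\<close> below \<open>a\<close>.\<close>

lemma critical_multidegree:
  fixes adj :: "'n::finite \<Rightarrow> 'n \<Rightarrow> bool"
  assumes sym: "\<And>i j. adj i j \<Longrightarrow> adj j i" and irrefl: "\<And>i. \<not> adj i i"
    and nonempty: "adj i0 j0" and k: "k \<ge> 1"
  defines "M \<equiv> edge_ge adj k"
  shows "\<exists>b g1 g2 f p q. critical M b g1 g2 \<and> adj p q \<and> lookup f p + lookup f q < k \<and>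
    f + single p 1 \<in> M \<and> f + single q 1 \<in> M \<and> b = f + single p 1 + single q 1"
proof -
  define U where "U a = {u \<in> M. u \<preceq> a}" for a
  define crit where "crit a \<longleftrightarrow> U a \<noteq> {} \<and> (\<nexists>m. least_mle (U a) m)" for a
  have up: "v \<in> M" if "u \<in> M" "u \<preceq> v" for u v
    using up_closedD[OF up_closed_edge_ge] that by (auto simp: M_def)
  \<comment> \<open>Below the constant vector \<open>k\<close>, lowering any single coordinate to 0
    stays in \<open>M\<close>, so a least element would have to be 0, which violates the edge
    \<open>{i0, j0}\<close>.\<close>
  have "crit (mk (\<lambda>_. k))"
    unfolding crit_def
  proof
    have "mk (\<lambda>_. k) \<in> U (mk (\<lambda>_. k))"
      by (simp add: U_def M_def edge_ge_def)
    then show "U (mk (\<lambda>_. k)) \<noteq> {}"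
      by blast
    show "\<nexists>m. least_mle (U (mk (\<lambda>_. k))) m"
    proof
      assume "\<exists>m. least_mle (U (mk (\<lambda>_. k))) m"
      then obtain m where m: "m \<in> U (mk (\<lambda>_. k))" "\<And>u. u \<in> U (mk (\<lambda>_. k)) \<Longrightarrow> m \<preceq> u"
        by (auto simp: least_mle_def)
      have "lookup m i = 0" for i
      proof -
        have "mk (\<lambda>l. if l = i then 0 else k) \<in> U (mk (\<lambda>_. k))"
          using irrefl by (auto simp: U_def M_def edge_ge_def mle_def)
        from mleD[OF m(2)[OF this], of i] show ?thesis
          by simp
      qed
      then show False
        using m(1) edge_geD[of m adj k i0 j0] nonempty k by (simp add: U_def M_def)
    qed
  qed
  then obtain a where a: "crit a" "\<And>a'. crit a' \<Longrightarrow> mdeg a \<le> mdeg a'"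
    using ex_has_least_nat[of crit _ mdeg] by blast
  have least: "\<exists>m. least_mle (U a') m" if "a' \<preceq> a" "a' \<noteq> a" "U a' \<noteq> {}" for a'
    using a(2)[of a'] mdeg_strict_mono[OF that(1,2)] that(3) by (auto simp: crit_def)
  have "a \<in> M"
    using a(1) up by (auto simp: crit_def U_def)

  \<comment> \<open>How far coordinate \<open>j\<close> alone can drop, all others being kept at
    \<open>a\<close>; since \<open>M\<close> is up-closed, this is the coordinatewise infimum of
    \<open>U a\<close>.\<close>
  define m where "m = mk (\<lambda>j. LEAST x. upd a j x \<in> M)"
  have "upd a j (lookup a j) = a" for j
    by (auto intro!: poly_mapping_eqI simp: lookup_upd)
  then have upd_m: "upd a j (lookup m j) \<in> M" for j
    using \<open>a \<in> M\<close> LeastI[of "\<lambda>x. upd a j x \<in> M" "lookup a j"] by (simp add: m_def)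
  have m_le: "m \<preceq> u" if "u \<in> M" "u \<preceq> a" for u
    unfolding mle_def
  proof
    fix j
    have "upd a j (lookup u j) \<in> M"
      using that(2) by (intro up[OF that(1)]) (auto simp: mle_def lookup_upd)
    then show "lookup m j \<le> lookup u j"
      by (simp add: m_def Least_le)
  qed
  have "m \<preceq> a"
    by (rule m_le) (use \<open>a \<in> M\<close> in auto)
  then have m_a: "lookup m j \<le> lookup a j" for j
    by (rule mleD)
  have "m \<notin> M"
  proof
    assume "m \<in> M"
    then have "least_mle (U a) m"
      using m_le \<open>m \<preceq> a\<close> by (auto simp: least_mle_def U_def)
    then show False
      using a(1) by (auto simp: crit_def)
  qed
  have mix: "k \<le> lookup m i + lookup a j" if "adj i j" for i j
    using edge_geD[OF upd_m[of i, unfolded M_def] that] irrefl that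
    by (auto simp: lookup_upd split: if_splits)

  \<comment> \<open>\<open>V\<close> is the support of \<open>a - m\<close>, and
    \<open>lower i\<close> is \<open>a\<close> with one factor \<open>x_i\<close> removed.
    Minimality of \<open>a\<close> provides the least element \<open>n i\<close> below it.\<close>
  define V where "V = {i. lookup m i < lookup a i}"
  define lower where "lower i = upd a i (lookup a i - 1)" for i
  have lower: "upd a i (lookup m i) \<in> U (lower i)" if "i \<in> V" for i
    using that upd_m[of i] by (auto simp: U_def lower_def mle_def lookup_upd V_def)
  have "\<exists>n. least_mle (U (lower i)) n" if "i \<in> V" for i
  proof (rule least)
    show "lower i \<preceq> a"
      by (simp add: lower_def mle_def lookup_upd)
    have "lookup (lower i) i \<noteq> lookup a i"
      using that by (simp add: lower_def lookup_upd V_def)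
    then show "lower i \<noteq> a"
      by metis
    show "U (lower i) \<noteq> {}"
      using lower[OF that] by blast
  qed
  then obtain n where n: "\<And>i. i \<in> V \<Longrightarrow> least_mle (U (lower i)) (n i)"
    by metis
  have n_M: "n i \<in> M" and n_lower: "n i \<preceq> lower i"
    and n_le: "\<And>u. u \<in> M \<Longrightarrow> u \<preceq> lower i \<Longrightarrow> n i \<preceq> u" if "i \<in> V" for i
    using n[OF that] by (auto simp: least_mle_def U_def)
  have lower_a: "lower i \<preceq> a" for i
    by (simp add: lower_def mle_def lookup_upd)
  have n_a: "n i \<preceq> a" if "i \<in> V" for i
    using n_lower[OF that] lower_a mle_trans by blast
  have m_n: "lookup m j \<le> lookup (n i) j" if "i \<in> V" for i j
    using m_le[OF n_M[OF that] n_a[OF that]] by (rule mleD)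
  have n_i: "lookup (n i) i = lookup m i" if "i \<in> V" for i
  proof -
    have "n i \<preceq> upd a i (lookup m i)"
      using lower[OF that] n_le[OF that] by (simp add: U_def)
    from mleD[OF this, of i] show ?thesis
      using m_n[OF that, of i] by (simp add: lookup_upd)
  qed
  have n_upper: "lookup (n i) j \<le> x"
    if i: "i \<in> V" and "j \<noteq> i" and x: "lookup m j \<le> x" "x \<le> lookup a j"
      and ij: "adj i j \<Longrightarrow> k \<le> lookup a i - 1 + x" for i j x
  proof -
    \<comment> \<open>Every edge condition at \<open>u\<close> follows from \<open>mix\<close> or
      from \<open>a\<close>, except the one for \<open>{i, j}\<close>, which the hypothesis on
      \<open>adj i j\<close> provides.\<close>
    define u where "u = upd (lower i) j x"
    have u: "lookup u l = (if l = j then x else if l = i then lookup a i - 1 else lookup a l)" for l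
      using \<open>j \<noteq> i\<close> by (simp add: u_def lower_def lookup_upd)
    have mi: "lookup m i \<le> lookup a i - 1"
      using i by (simp add: V_def)
    have "u \<in> M"
      unfolding M_def edge_ge_def
    proof (intro CollectI allI impI)
      fix s t assume st: "adj s t"
      have facts: "s \<noteq> t" "k \<le> lookup m s + lookup a t" "k \<le> lookup m t + lookup a s"
          "k \<le> lookup a s + lookup a t"
        using st irrefl mix[OF st] mix[OF sym[OF st]] edge_geD[of a adj k s t] \<open>a \<in> M\<close>
        by (auto simp: M_def)
      show "k \<le> lookup u s + lookup u t"
        using facts ij mi x st sym[OF st] by (auto simp: u add.commute)
    qed
    moreover have "u \<preceq> lower i"
      using x(2) \<open>j \<noteq> i\<close> by (simp add: u_def mle_def lookup_upd lower_def)
    ultimately have "n i \<preceq> u"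
      by (rule n_le[OF i])
    from mleD[OF this, of j] show ?thesis
      by (simp add: u)
  qed
  have a_V: "lookup a i = lookup m i + 1" if i: "i \<in> V" for i
  proof -
    \<comment> \<open>As \<open>m\<close> is not in \<open>M\<close>, some coordinate
      \<open>j\<close> of \<open>n i\<close> exceeds \<open>m\<close>. Then \<open>n_upper\<close>
      with \<open>x = m_j\<close> forces an edge with \<open>a_i - 1 + m_j < k\<close>, while with
      \<open>x = m_j + 1\<close> it bounds \<open>n i\<close> at \<open>j\<close>; together with
      \<open>k \<le> m_i + m_j + 1\<close> this leaves \<open>a_i = m_i + 1\<close>.\<close>
    have "n i \<noteq> m"
      using n_M[OF i] \<open>m \<notin> M\<close> by metis
    then obtain j where j: "lookup (n i) j \<noteq> lookup m j"
      by (meson poly_mapping_eqI)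
    then have "j \<noteq> i"
      using n_i[OF i] by auto
    have "lookup m j < lookup (n i) j"
      using j m_n[OF i, of j] by simp
    then have less: "adj i j" "lookup a i - 1 + lookup m j < k"
      using n_upper[OF i \<open>j \<noteq> i\<close>, of "lookup m j"] m_a[of j] by force+
    have "lookup (n i) j \<le> lookup m j + 1"
    proof (rule n_upper[OF i \<open>j \<noteq> i\<close>])
      show "lookup m j + 1 \<le> lookup a j"
        using \<open>lookup m j < lookup (n i) j\<close> mleD[OF n_a[OF i], of j] by simp
      show "k \<le> lookup a i - 1 + (lookup m j + 1)"
        using mix[OF sym[OF less(1)]] i by (simp add: V_def)
    qed simp
    moreover have "k \<le> lookup (n i) i + lookup (n i) j"
      using n_M[OF i] edge_geD less(1) by (auto simp: M_def)
    ultimately show ?thesis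
      using n_i[OF i] less(2) i by (simp add: V_def)
  qed
  \<comment> \<open>The edges that \<open>m\<close> misses by exactly one. By \<open>mix\<close> and
    \<open>a_V\<close>, an edge violated by \<open>m\<close> cannot be missed by more.\<close>
  define E where "E i j \<longleftrightarrow> adj i j \<and> lookup m i + lookup m j + 1 = k" for i j
  have E_sym: "E i j \<Longrightarrow> E j i" for i j
    using sym by (auto simp: E_def)
  have n_eq: "lookup (n i) j = lookup m j + (if E i j then 1 else 0)" if i: "i \<in> V" for i j
  proof (cases "E i j")
    case True
    then have "j \<noteq> i"
      using irrefl by (auto simp: E_def)
    have "k \<le> lookup (n i) i + lookup (n i) j"
      using n_M[OF i] edge_geD True by (auto simp: M_def E_def)
    then have ge: "lookup m j + 1 \<le> lookup (n i) j"
      using n_i[OF i] True by (simp add: E_def)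
    have "lookup (n i) j \<le> lookup m j + 1"
    proof (rule n_upper[OF i \<open>j \<noteq> i\<close>])
      show "lookup m j + 1 \<le> lookup a j"
        using ge mleD[OF n_a[OF i], of j] by simp
      show "k \<le> lookup a i - 1 + (lookup m j + 1)"
        using True a_V[OF i] by (simp add: E_def)
    qed simp
    then show ?thesis
      using ge True by simp
  next
    case False
    show ?thesis
    proof (cases "j = i")
      case True
      then show ?thesis
        using n_i[OF i] False by simp
    next
      case False
      have "lookup (n i) j \<le> lookup m j"
      proof (rule n_upper[OF i False])
        assume "adj i j"
        then show "k \<le> lookup a i - 1 + lookup m j"
          using mix[OF sym, of i j] \<open>\<not> E i j\<close> a_V[OF i] by (simp add: E_def)
      qed (simp_all add: m_a)
      then show ?thesis
        using m_n[OF i, of j] \<open>\<not> E i j\<close> by simp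
    qed
  qed

  obtain p q where pq: "adj p q" "lookup m p + lookup m q < k"
    using \<open>m \<notin> M\<close> by (auto simp: M_def edge_ge_def not_le)
  have pV: "p \<in> V" and qV: "q \<in> V"
    using mix[OF pq(1)] mix[OF sym[OF pq(1)]] pq(2) by (auto simp: V_def)
  have "E p q"
    using mix[OF sym[OF pq(1)]] a_V[OF pV] pq by (simp add: E_def)
  have "p \<noteq> q"
    using pq(1) irrefl by auto
  have lower_M: "lower i \<in> M" if "i \<in> V" for i
    using lower[OF that] up by (auto simp: U_def)
  \<comment> \<open>On \<open>p\<close> and \<open>q\<close> this agrees with \<open>m\<close>, so
    it misses the edge \<open>{p, q}\<close>; restoring either variable gives \<open>lower q\<close>
    or \<open>lower p\<close>, which lie in \<open>M\<close>.\<close>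
  define f where "f = a - single p 1 - single q 1"
  have f1: "f + single p 1 = lower q" and f2: "f + single q 1 = lower p"
    and f3: "a = f + single p 1 + single q 1"
    using a_V[OF pV] a_V[OF qV] \<open>p \<noteq> q\<close>
    by (auto intro!: poly_mapping_eqI simp: f_def lower_def lookup_upd lookup_add lookup_minus)
  have "critical M a (n p) (n q)"
    unfolding critical_def
  proof (intro conjI ballI allI impI)
    show "n p \<in> M" "n p \<preceq> a" "n q \<in> M" "n q \<preceq> a"
      using n_M n_a pV qV by auto
    have "lookup (n q) q < lookup (n p) q"
      using n_eq[OF pV, of q] n_i[OF qV] \<open>E p q\<close> by simp
    then show "\<not> n p \<preceq> n q"
      using mleD[of "n p" "n q" q] by auto
    show "n p \<preceq> u" if that: "u \<in> M" "u \<preceq> n p" for u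
      using n_le[OF pV that(1)] n_lower[OF pV] mle_trans[OF that(2)] by blast
    show "(\<forall>u\<in>M. u \<preceq> \<beta> \<longrightarrow> n p \<preceq> u) \<or> (\<forall>u\<in>M. u \<preceq> \<beta> \<longrightarrow> \<not> n p \<preceq> u)"
      if \<beta>: "\<beta> \<preceq> a" "\<beta> \<noteq> a" for \<beta>
    proof -
      obtain i where "lookup \<beta> i \<noteq> lookup a i"
        using \<beta>(2) by (meson poly_mapping_eqI)
      then have i: "lookup \<beta> i < lookup a i"
        using mleD[OF \<beta>(1), of i] by simp
      show ?thesis
      proof (cases "i \<in> V")
        case False
        have "\<not> u \<preceq> \<beta>" if "u \<in> M" for u
        proof
          assume "u \<preceq> \<beta>"
          then have "lookup m i \<le> lookup \<beta> i"
            using m_le[OF that] mle_trans[OF _ \<beta>(1)] mleD le_trans by metis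
          then show False
            using i False by (simp add: V_def)
        qed
        then show ?thesis
          by blast
      next
        case True
        have "\<beta> \<preceq> lower i"
          using \<beta>(1) i by (auto simp: lower_def mle_def lookup_upd)
        then have *: "n i \<preceq> u" if "u \<in> M" "u \<preceq> \<beta>" for u
          using n_le[OF True that(1)] mle_trans[OF that(2)] by blast
        show ?thesis
        proof (cases "n p \<preceq> n i")
          case True
          then show ?thesis
            using * mle_trans by blast
        next
          case False
          then obtain j where "\<not> lookup (n p) j \<le> lookup (n i) j"
            by (auto simp: mle_def)
          \<comment> \<open>The complete multipartite property: \<open>n i\<close> must satisfy the
            edge \<open>{p, j}\<close> without being raised at \<open>j\<close>, so it is raised at
            \<open>p\<close>, that is, \<open>E i p\<close>. Hence \<open>n p\<close> already
            reaches \<open>a\<close> at \<open>i\<close>, where \<open>\<beta>\<close> is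
            smaller.\<close>
          then have j: "E p j" "\<not> E i j"
            using n_eq[OF pV, of j] n_eq[OF True, of j] by (auto split: if_splits)
          have "k \<le> lookup (n i) p + lookup (n i) j"
            using n_M[OF True] edge_geD j(1) by (auto simp: M_def E_def)
          then have "E i p"
            using n_eq[OF True, of p] n_eq[OF True, of j] j by (auto simp: E_def split: if_splits)
          then have "lookup (n p) i = lookup a i"
            using n_eq[OF pV, of i] E_sym a_V[OF True] by simp
          then have "\<not> n p \<preceq> u" if "u \<preceq> \<beta>" for u
            using i mleD[OF that, of i] mleD[of "n p" u i] by linarith
          then show ?thesis
            by blast
        qed
      qed
    qed
  qed
  moreover have "lookup f p + lookup f q < k"
    using a_V[OF pV] a_V[OF qV] \<open>p \<noteq> q\<close> pq(2) by (simp add: f_def lookup_minus)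
  moreover have "f + single p 1 \<in> M" "f + single q 1 \<in> M"
    using lower_M pV qV f1 f2 by auto
  ultimately show ?thesis
    using pq(1) f3 by blast
qed

section \<open>Multigraded linear algebra\<close>

text \<open>Coordinate vectors of all lengths share one type, so that every stage of the resolution
  lives in the same vector space. The product is convolution, hence multiplying by
  \<open>single 0 c\<close> rescales.\<close>

definition scale :: "'k::field \<Rightarrow> (nat \<Rightarrow>\<^sub>0 'k) \<Rightarrow> (nat \<Rightarrow>\<^sub>0 'k)"
  where "scale c v = single 0 c * v"

lemma lookup_scale [simp]: "lookup (scale c v) i = c * lookup v i"
  unfolding scale_def mult_map_scale_conv_mult[symmetric] by (simp add: Poly_Mapping.map.rep_eq when_def)

global_interpretation coord: vector_space "scale :: 'k::field \<Rightarrow> _"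
proof unfold_locales
  fix a b :: 'k and x y :: "nat \<Rightarrow>\<^sub>0 'k"
  show "scale a (x + y) = scale a x + scale a y"
    unfolding scale_def by (rule distrib_left)
  show "scale (a + b) x = scale a x + scale b x"
    unfolding scale_def single_add by (rule distrib_right)
  show "scale a (scale b x) = scale (a * b) x"
    by (rule poly_mapping_eqI) (simp only: lookup_scale mult.assoc)
  show "scale 1 x = x"
    by (rule poly_mapping_eqI) (simp only: lookup_scale mult_1_left)
qed

lemma coord_subspace_keys: "coord.subspace {v :: nat \<Rightarrow>\<^sub>0 'k::field. keys v \<subseteq> S}"
proof (rule coord.subspaceI)
  fix v w :: "nat \<Rightarrow>\<^sub>0 'k"
  assume "v \<in> {v. keys v \<subseteq> S}" "w \<in> {v. keys v \<subseteq> S}"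
  then show "v + w \<in> {v. keys v \<subseteq> S}"
    using keys_add[of v w] by auto
qed (auto simp: in_keys_iff)

lemma finite_spanning_subset:
  fixes V :: "(nat \<Rightarrow>\<^sub>0 'k::field) set"
  assumes "\<And>v. v \<in> V \<Longrightarrow> keys v \<subseteq> {..<N}"
  shows "\<exists>B. finite B \<and> B \<subseteq> V \<and> V \<subseteq> coord.span B"
proof -
  define T where "T = (\<lambda>i. single i (1 :: 'k)) ` {..<N}"
  have V_T: "v \<in> coord.span T" if v: "v \<in> V" for v
  proof -
    have "v = (\<Sum>i\<in>keys v. scale (lookup v i) (single i 1))"
      by (rule poly_mapping_eqI)
        (auto simp: lookup_sum lookup_single when_def in_keys_iff if_distrib cong: if_cong)
    also have "\<dots> \<in> coord.span T"
      using assms[OF v]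
      by (intro coord.span_sum coord.span_scale coord.span_base) (auto simp: T_def)
    finally show ?thesis .
  qed
  obtain B where B: "B \<subseteq> V" "coord.independent B" "V \<subseteq> coord.span B"
    using coord.maximal_independent_subset[of V] by metis
  have "finite B"
    using coord.independent_span_bound[of T B] B V_T by (auto simp: T_def)
  then show ?thesis
    using B by blast
qed

text \<open>A multihomogeneous element of a free module: its multidegree and its scalars. The
  monomial in each coordinate is determined by the multidegree and is left out.\<close>

type_synonym ('n, 'k) mvec = "('n \<Rightarrow>\<^sub>0 nat) \<times> (nat \<Rightarrow>\<^sub>0 'k)"

definition cap :: "('n::finite \<Rightarrow>\<^sub>0 nat) \<Rightarrow> ('n \<Rightarrow>\<^sub>0 nat) \<Rightarrow> ('n \<Rightarrow>\<^sub>0 nat)"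
  where "cap u v = mk (\<lambda>i. min (lookup u i) (lookup v i))"

lemma mle_cap_iff: "w \<preceq> cap u v \<longleftrightarrow> w \<preceq> u \<and> w \<preceq> v"
  by (auto simp: cap_def mle_def)

lemma cap_mle: "cap u v \<preceq> u" "cap u v \<preceq> v"
  using mle_cap_iff[of "cap u v" u v] by simp_all

text \<open>\<open>V \<beta>\<close> plays the role of the degree \<open>\<beta>\<close> part of a multigraded submodule of a free module of
  rank \<open>N\<close>: the inclusions \<open>V \<beta> \<subseteq> V \<gamma>\<close> are multiplication by \<open>x\<^sup>\<gamma>\<^sup>-\<^sup>\<beta>\<close>, and the submodule is generated
  in degrees below \<open>bound\<close>.\<close>

definition graded_family ::
  "nat \<Rightarrow> ('n::finite \<Rightarrow>\<^sub>0 nat) \<Rightarrow> (('n \<Rightarrow>\<^sub>0 nat) \<Rightarrow> (nat \<Rightarrow>\<^sub>0 'k::field) set) \<Rightarrow> bool"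
where
  "graded_family N bound V \<longleftrightarrow>
     (\<forall>\<beta>. coord.subspace (V \<beta>)) \<and>
     (\<forall>\<beta> \<gamma>. \<beta> \<preceq> \<gamma> \<longrightarrow> V \<beta> \<subseteq> V \<gamma>) \<and>
     (\<forall>\<beta>. V \<beta> \<subseteq> V (cap bound \<beta>)) \<and>
     (\<forall>\<beta>. \<forall>v\<in>V \<beta>. keys v \<subseteq> {..<N})"

definition gens_below :: "('n, 'k::zero) mvec set \<Rightarrow> ('n \<Rightarrow>\<^sub>0 nat) \<Rightarrow> (nat \<Rightarrow>\<^sub>0 'k) set"
  where "gens_below L \<beta> = snd ` {x \<in> L. fst x \<preceq> \<beta>}"

definition generates ::
  "('n \<Rightarrow>\<^sub>0 nat) \<Rightarrow> (('n \<Rightarrow>\<^sub>0 nat) \<Rightarrow> (nat \<Rightarrow>\<^sub>0 'k::field) set) \<Rightarrow> ('n, 'k) mvec set \<Rightarrow> bool"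
where
  "generates bound V L \<longleftrightarrow> finite L \<and> (\<forall>x\<in>L. fst x \<preceq> bound \<and> snd x \<in> V (fst x)) \<and>
     (\<forall>\<beta>. V \<beta> \<subseteq> coord.span (gens_below L \<beta>))"

definition min_gens ::
  "('n \<Rightarrow>\<^sub>0 nat) \<Rightarrow> (('n \<Rightarrow>\<^sub>0 nat) \<Rightarrow> (nat \<Rightarrow>\<^sub>0 'k::field) set) \<Rightarrow> ('n, 'k) mvec list \<Rightarrow> bool"
where
  "min_gens bound V xs \<longleftrightarrow> generates bound V (set xs) \<and> distinct xs \<and>
     (\<forall>x\<in>set xs. snd x \<notin> coord.span (gens_below (set xs - {x}) (fst x)))"

lemma gens_below_mono: "\<beta> \<preceq> \<gamma> \<Longrightarrow> gens_below L \<beta> \<subseteq> gens_below L \<gamma>"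
  unfolding gens_below_def using mle_trans by blast

text \<open>Spanning sets for the finitely many degrees below \<open>bound\<close> suffice, since
  degree \<open>\<beta>\<close> is already reached from \<open>cap bound \<beta>\<close>.\<close>

lemma ex_generates:
  assumes V: "graded_family N bound V"
  shows "\<exists>L. generates bound V L"
proof -
  have "\<exists>B. finite B \<and> B \<subseteq> V \<beta> \<and> V \<beta> \<subseteq> coord.span B" for \<beta>
    using V by (intro finite_spanning_subset[of _ N]) (auto simp: graded_family_def)
  then obtain B where B: "\<And>\<beta>. finite (B \<beta>)" "\<And>\<beta>. B \<beta> \<subseteq> V \<beta>" "\<And>\<beta>. V \<beta> \<subseteq> coord.span (B \<beta>)"
    by metis
  define L where "L = Sigma {\<beta>. \<beta> \<preceq> bound} B"
  have "finite L"
    unfolding L_def by (intro finite_SigmaI finite_below B)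
  moreover have "V \<beta> \<subseteq> coord.span (gens_below L \<beta>)" for \<beta>
  proof -
    have "(cap bound \<beta>, v) \<in> {x \<in> L. fst x \<preceq> \<beta>}" if "v \<in> B (cap bound \<beta>)" for v
      using that by (simp add: L_def cap_mle)
    then have "B (cap bound \<beta>) \<subseteq> gens_below L \<beta>"
      unfolding gens_below_def by force
    then have "coord.span (B (cap bound \<beta>)) \<subseteq> coord.span (gens_below L \<beta>)"
      by (rule coord.span_mono)
    moreover have "V \<beta> \<subseteq> V (cap bound \<beta>)"
      using V by (simp add: graded_family_def)
    ultimately show ?thesis
      using B(3) by blast
  qed
  ultimately have "generates bound V L"
    using B(2) by (auto simp: generates_def L_def)
  then show ?thesis
    by blast
qed

text \<open>A generating set of least cardinality works: a redundant element could be deleted in all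
  degrees at once.\<close>

lemma ex_min_gens:
  assumes V: "graded_family N bound V"
  shows "\<exists>xs. min_gens bound V xs"
proof -
  obtain L where L: "generates bound V L" "\<And>L'. generates bound V L' \<Longrightarrow> card L \<le> card L'"
    using ex_has_least_nat[of "generates bound V" _ card] ex_generates[OF V] by blast
  have "finite L"
    using L(1) by (simp add: generates_def)
  have "snd x \<notin> coord.span (gens_below (L - {x}) (fst x))" if x: "x \<in> L" for x
  proof
    assume redundant: "snd x \<in> coord.span (gens_below (L - {x}) (fst x))"
    have "gens_below L \<beta> \<subseteq> coord.span (gens_below (L - {x}) \<beta>)" for \<beta>
    proof
      fix v assume "v \<in> gens_below L \<beta>"
      then obtain y where y: "y \<in> L" "fst y \<preceq> \<beta>" "v = snd y"
        by (auto simp: gens_below_def)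
      show "v \<in> coord.span (gens_below (L - {x}) \<beta>)"
      proof (cases "y = x")
        case True
        then show ?thesis
          using redundant coord.span_mono[OF gens_below_mono, of "fst x" \<beta> "L - {x}"] y by blast
      next
        case False
        then show ?thesis
          using y by (intro coord.span_base) (auto simp: gens_below_def)
      qed
    qed
    then have "coord.span (gens_below L \<beta>) \<subseteq> coord.span (gens_below (L - {x}) \<beta>)" for \<beta>
      by (intro coord.span_minimal coord.subspace_span)
    then have "generates bound V (L - {x})"
      using L(1) unfolding generates_def by (meson DiffD1 finite_Diff order_trans)
    then have "card L \<le> card (L - {x})"
      by (rule L(2))
    then show False
      using card_Diff1_less[OF \<open>finite L\<close> x] by simp
  qed
  moreover obtain xs where "set xs = L" "distinct xs"
    using finite_distinct_list[OF \<open>finite L\<close>] by blast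
  ultimately show ?thesis
    using L(1) unfolding min_gens_def by blast
qed

text \<open>The differential on scalars, with all monomials suppressed.\<close>

definition lincomb :: "('n, 'k::field) mvec list \<Rightarrow> (nat \<Rightarrow>\<^sub>0 'k) \<Rightarrow> (nat \<Rightarrow>\<^sub>0 'k)"
  where "lincomb xs w = (\<Sum>i<length xs. scale (lookup w i) (snd (xs ! i)))"

definition idx_below :: "('n, 'k::zero) mvec list \<Rightarrow> ('n \<Rightarrow>\<^sub>0 nat) \<Rightarrow> nat set"
  where "idx_below xs \<beta> = {i. i < length xs \<and> fst (xs ! i) \<preceq> \<beta>}"

definition syz :: "('n, 'k::field) mvec list \<Rightarrow> ('n \<Rightarrow>\<^sub>0 nat) \<Rightarrow> (nat \<Rightarrow>\<^sub>0 'k) set"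
  where "syz xs \<beta> = {w. keys w \<subseteq> idx_below xs \<beta> \<and> lincomb xs w = 0}"

lemma lookup_lincomb:
  "lookup (lincomb xs w) r = (\<Sum>i<length xs. lookup w i * lookup (snd (xs ! i)) r)"
  by (simp add: lincomb_def lookup_sum)

lemma lincomb_zero [simp]: "lincomb xs 0 = 0"
  by (rule poly_mapping_eqI) (simp add: lookup_lincomb)

lemma lincomb_add: "lincomb xs (v + w) = lincomb xs v + lincomb xs w"
  by (rule poly_mapping_eqI) (simp add: lookup_lincomb lookup_add distrib_right sum.distrib)

lemma lincomb_scale: "lincomb xs (scale c w) = scale c (lincomb xs w)"
  by (rule poly_mapping_eqI) (simp only: lookup_lincomb lookup_scale mult.assoc sum_distrib_left)

lemma lincomb_single: "i < length xs \<Longrightarrow> lincomb xs (single i 1) = snd (xs ! i)"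
  by (rule poly_mapping_eqI)
    (simp add: lookup_lincomb lookup_single when_def if_distrib[of "\<lambda>x. x * _"] cong: if_cong)

text \<open>A generator of degree below \<open>bound\<close> is available in degree
  \<open>\<beta>\<close> exactly if it is in degree \<open>cap bound \<beta>\<close>. Thus one
  \<open>bound\<close> serves all stages.\<close>

lemma graded_family_syz:
  assumes "\<And>x. x \<in> set xs \<Longrightarrow> fst x \<preceq> bound"
  shows "graded_family (length xs) bound (syz xs)"
  unfolding graded_family_def
proof (intro conjI allI impI ballI)
  fix \<beta>
  show "coord.subspace (syz xs \<beta>)"
  proof (rule coord.subspaceI)
    fix v w assume "v \<in> syz xs \<beta>" "w \<in> syz xs \<beta>"
    then show "v + w \<in> syz xs \<beta>"
      using keys_add[of v w] by (auto simp: syz_def lincomb_add)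
  next
    fix c v assume "v \<in> syz xs \<beta>"
    then show "scale c v \<in> syz xs \<beta>"
      using coord.subspace_scale[OF coord_subspace_keys, of v "idx_below xs \<beta>" c]
      by (simp add: syz_def lincomb_scale)
  qed (simp add: syz_def)
  show "syz xs \<beta> \<subseteq> syz xs (cap bound \<beta>)"
    using assms[OF nth_mem] by (auto simp: syz_def idx_below_def mle_cap_iff)
  show "keys v \<subseteq> {..<length xs}" if "v \<in> syz xs \<beta>" for v
    using that by (auto simp: syz_def idx_below_def)
  show "syz xs \<beta> \<subseteq> syz xs \<gamma>" if "\<beta> \<preceq> \<gamma>" for \<gamma>
    using that mle_trans unfolding syz_def idx_below_def by blast
qed

lemma min_gens_lincomb:
  assumes V: "graded_family N bound V" and xs: "min_gens bound V xs"
  shows "v \<in> V \<beta> \<longleftrightarrow> (\<exists>w. keys w \<subseteq> idx_below xs \<beta> \<and> v = lincomb xs w)"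
proof
  let ?C = "{v. \<exists>w. keys w \<subseteq> idx_below xs \<beta> \<and> v = lincomb xs w}"
  have "coord.subspace ?C"
  proof (rule coord.subspaceI)
    show "0 \<in> ?C"
      by (auto intro: exI[of _ 0])
  next
    fix u v assume "u \<in> ?C" "v \<in> ?C"
    then obtain w w' where "keys w \<subseteq> idx_below xs \<beta>" "u = lincomb xs w"
      "keys w' \<subseteq> idx_below xs \<beta>" "v = lincomb xs w'"
      by blast
    then have "keys (w + w') \<subseteq> idx_below xs \<beta>" "u + v = lincomb xs (w + w')"
      using keys_add[of w w'] by (auto simp: lincomb_add)
    then show "u + v \<in> ?C"
      by blast
  next
    fix c u assume "u \<in> ?C"
    then obtain w where w: "keys w \<subseteq> idx_below xs \<beta>" "u = lincomb xs w"
      by blast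
    then have "keys (scale c w) \<subseteq> idx_below xs \<beta>" "scale c u = lincomb xs (scale c w)"
      using coord.subspace_scale[OF coord_subspace_keys, of w "idx_below xs \<beta>" c]
      by (simp_all add: lincomb_scale)
    then show "scale c u \<in> ?C"
      by blast
  qed
  moreover have "gens_below (set xs) \<beta> \<subseteq> ?C"
  proof
    fix v assume "v \<in> gens_below (set xs) \<beta>"
    then obtain i where i: "i < length xs" "fst (xs ! i) \<preceq> \<beta>" "v = snd (xs ! i)"
      by (auto simp: gens_below_def in_set_conv_nth)
    then have "keys (single i (1 :: 'b)) \<subseteq> idx_below xs \<beta>" "v = lincomb xs (single i 1)"
      by (auto simp: idx_below_def lincomb_single)
    then show "v \<in> ?C"
      by blast
  qed
  ultimately have "coord.span (gens_below (set xs) \<beta>) \<subseteq> ?C"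
    by (intro coord.span_minimal)
  moreover have "V \<beta> \<subseteq> coord.span (gens_below (set xs) \<beta>)"
    using xs by (simp add: min_gens_def generates_def)
  ultimately show "\<exists>w. keys w \<subseteq> idx_below xs \<beta> \<and> v = lincomb xs w" if "v \<in> V \<beta>"
    using that by blast
next
  assume "\<exists>w. keys w \<subseteq> idx_below xs \<beta> \<and> v = lincomb xs w"
  then obtain w where w: "keys w \<subseteq> idx_below xs \<beta>" "v = lincomb xs w"
    by blast
  have sub: "coord.subspace (V \<beta>)"
    using V by (simp add: graded_family_def)
  show "v \<in> V \<beta>"
    unfolding w(2) lincomb_def
  proof (rule coord.subspace_sum[OF sub])
    fix i assume i: "i \<in> {..<length xs}"
    show "scale (lookup w i) (snd (xs ! i)) \<in> V \<beta>"
    proof (cases "i \<in> keys w")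
      case True
      then have "fst (xs ! i) \<preceq> \<beta>"
        using w(1) by (auto simp: idx_below_def)
      then have "V (fst (xs ! i)) \<subseteq> V \<beta>"
        using V by (simp add: graded_family_def)
      moreover have "snd (xs ! i) \<in> V (fst (xs ! i))"
        using xs i by (simp add: min_gens_def generates_def)
      ultimately show ?thesis
        by (intro coord.subspace_scale[OF sub]) blast
    next
      case False
      then show ?thesis
        using coord.subspace_0[OF sub] by (simp add: in_keys_iff)
    qed
  qed
qed

text \<open>A generator occurring in a syzygy of its own degree has a scalar as coefficient;
  dividing by it would make that generator redundant. This is the source of minimality and of
  strictly rising degrees.\<close>

lemma min_gens_syz_neq:
  assumes xs: "min_gens bound V xs" and w: "w \<in> syz xs \<beta>" and i: "lookup w i \<noteq> 0"
  shows "fst (xs ! i) \<noteq> \<beta>"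
proof
  assume \<beta>: "fst (xs ! i) = \<beta>"
  have w_below: "j < length xs \<and> fst (xs ! j) \<preceq> \<beta>" if "lookup w j \<noteq> 0" for j
  proof -
    have "j \<in> idx_below xs \<beta>"
      using w that unfolding syz_def in_keys_iff[symmetric] by blast
    then show ?thesis
      by (simp add: idx_below_def)
  qed
  then have iw: "i < length xs"
    using i by blast
  have w0: "lincomb xs w = 0"
    using w by (simp add: syz_def)
  let ?S = "gens_below (set xs - {xs ! i}) \<beta>"
  have "scale (lookup w i) (snd (xs ! i)) +
      (\<Sum>j\<in>{..<length xs} - {i}. scale (lookup w j) (snd (xs ! j))) = 0"
    using w0 iw sum.remove[of "{..<length xs}" i "\<lambda>j. scale (lookup w j) (snd (xs ! j))"]
    by (simp add: lincomb_def)
  then have "- scale (lookup w i) (snd (xs ! i)) =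
      (\<Sum>j\<in>{..<length xs} - {i}. scale (lookup w j) (snd (xs ! j)))"
    by (rule minus_unique)
  moreover have "(\<Sum>j\<in>{..<length xs} - {i}. scale (lookup w j) (snd (xs ! j))) \<in> coord.span ?S"
  proof (rule coord.span_sum)
    fix j assume j: "j \<in> {..<length xs} - {i}"
    show "scale (lookup w j) (snd (xs ! j)) \<in> coord.span ?S"
    proof (cases "lookup w j = 0")
      case True
      then show ?thesis
        by (simp add: coord.span_zero)
    next
      case False
      then have "fst (xs ! j) \<preceq> \<beta>"
        using w_below by blast
      moreover have "xs ! j \<noteq> xs ! i"
        using xs j iw by (simp add: min_gens_def nth_eq_iff_index_eq)
      ultimately have "snd (xs ! j) \<in> ?S"
        using j unfolding gens_below_def by auto
      then show ?thesis
        by (intro coord.span_scale coord.span_base)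
    qed
  qed
  ultimately have "- scale (lookup w i) (snd (xs ! i)) \<in> coord.span ?S"
    by simp
  then have "scale (- inverse (lookup w i)) (- scale (lookup w i) (snd (xs ! i))) \<in> coord.span ?S"
    by (rule coord.span_scale)
  moreover have "scale (- inverse (lookup w i)) (- scale (lookup w i) (snd (xs ! i))) = snd (xs ! i)"
    using i by (intro poly_mapping_eqI) simp
  ultimately have "snd (xs ! i) \<in> coord.span ?S"
    by simp
  moreover have "snd (xs ! i) \<notin> coord.span (gens_below (set xs - {xs ! i}) (fst (xs ! i)))"
    using xs nth_mem[OF iw] unfolding min_gens_def by blast
  ultimately show False
    unfolding \<beta> by blast
qed

section \<open>Existence of finite minimal graded free resolutions\<close>

text \<open>The matrix of the multigraded map sending the \<open>c\<close>-th basis element, of multidegree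
  \<open>fst (xs ! c)\<close>, to the combination \<open>snd (xs ! c)\<close> of basis elements of multidegrees \<open>bs\<close>.\<close>

definition diff_mat :: "('n \<Rightarrow>\<^sub>0 nat) list \<Rightarrow> ('n, 'k::field) mvec list \<Rightarrow> ('n, 'k) mpoly mat" where
  "diff_mat bs xs = mat (length bs) (length xs)
     (\<lambda>(r, c). single (fst (xs ! c) - bs ! r) (lookup (snd (xs ! c)) r))"

text \<open>Ensures that the truncated subtraction of exponents in \<open>diff_mat\<close> is a true
  one wherever the coefficient is nonzero.\<close>

definition well_graded :: "('n \<Rightarrow>\<^sub>0 nat) list \<Rightarrow> ('n, 'k::field) mvec list \<Rightarrow> bool" where
  "well_graded bs xs \<longleftrightarrow>
     (\<forall>x\<in>set xs. \<forall>r. lookup (snd x) r \<noteq> 0 \<longrightarrow> r < length bs \<and> bs ! r \<preceq> fst x)"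

text \<open>The scalars of the degree \<open>\<beta>\<close> part of \<open>u\<close>, in the free
  module whose \<open>c\<close>-th basis element has degree \<open>bs ! c\<close>.\<close>

definition component :: "('n \<Rightarrow>\<^sub>0 nat) list \<Rightarrow> ('n, 'k::field) mpoly vec \<Rightarrow> ('n \<Rightarrow>\<^sub>0 nat) \<Rightarrow> (nat \<Rightarrow>\<^sub>0 'k)" where
  "component bs u \<beta> = Abs_poly_mapping
     (\<lambda>c. if c < length bs \<and> bs ! c \<preceq> \<beta> then lookup (u $ c) (\<beta> - bs ! c) else 0)"

lemma lookup_component:
  "lookup (component bs u \<beta>) c =
    (if c < length bs \<and> bs ! c \<preceq> \<beta> then lookup (u $ c) (\<beta> - bs ! c) else 0)"
proof -
  have "finite {c. (if c < length bs \<and> bs ! c \<preceq> \<beta> then lookup (u $ c) (\<beta> - bs ! c) else 0) \<noteq> 0}"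
    by (rule finite_subset[of _ "{..<length bs}"]) auto
  then show ?thesis
    unfolding component_def by (subst lookup_Abs_poly_mapping) auto
qed

lemma keys_component: "keys (component (map fst xs) u \<beta>) \<subseteq> idx_below xs \<beta>"
  by (auto simp: in_keys_iff lookup_component idx_below_def split: if_splits)

lemma diff_mat_carrier: "diff_mat bs xs \<in> carrier_mat (length bs) (length xs)"
  by (simp add: diff_mat_def)

lemma finite_components:
  fixes u :: "('n, 'k::field) mpoly vec"
  shows "finite {\<beta>. component bs u \<beta> \<noteq> 0}"
proof (rule finite_subset)
  show "finite (\<Union>c<length bs. (\<lambda>m. m + bs ! c) ` keys (u $ c))"
    by simp
  show "{\<beta>. component bs u \<beta> \<noteq> 0} \<subseteq> (\<Union>c<length bs. (\<lambda>m. m + bs ! c) ` keys (u $ c))"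
  proof
    fix \<beta> assume "\<beta> \<in> {\<beta>. component bs u \<beta> \<noteq> 0}"
    then obtain c where "lookup (component bs u \<beta>) c \<noteq> 0"
      by (metis (mono_tags) lookup_zero mem_Collect_eq poly_mapping_eqI)
    then have c: "c < length bs" "bs ! c \<preceq> \<beta>" "lookup (u $ c) (\<beta> - bs ! c) \<noteq> 0"
      by (auto simp: lookup_component split: if_splits)
    then have "\<beta> = (\<beta> - bs ! c) + bs ! c" "\<beta> - bs ! c \<in> keys (u $ c)"
      by (simp_all add: in_keys_iff)
    then show "\<beta> \<in> (\<Union>c<length bs. (\<lambda>m. m + bs ! c) ` keys (u $ c))"
      using c(1) by blast
  qed
qed

lemma component_eqD:
  assumes "u \<in> carrier_vec (length bs)" "v \<in> carrier_vec (length bs)"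
    and "\<And>\<beta>. component bs u \<beta> = component bs v \<beta>"
  shows "u = v"
proof (rule eq_vecI)
  fix r assume "r < dim_vec v"
  then have r: "r < length bs"
    using assms by simp
  have "lookup (u $ r) g = lookup (v $ r) g" for g
  proof -
    have "lookup (component bs u (g + bs ! r)) r = lookup (component bs v (g + bs ! r)) r"
      using assms(3) by simp
    then show ?thesis
      using r by (simp add: lookup_component)
  qed
  then show "u $ r = v $ r"
    by (rule poly_mapping_eqI)
qed (use assms in simp)

text \<open>In a fixed multidegree all monomials are forced, so the polynomial matrix acts by
  scalars. Kernels and images thereby reduce to linear algebra degree by degree.\<close>

lemma component_diff_mat:
  fixes xs :: "('n, 'k::field) mvec list"
  assumes graded: "well_graded bs xs" and v: "v \<in> carrier_vec (length xs)"
  shows "component bs (diff_mat bs xs *\<^sub>v v) \<beta> = lincomb xs (component (map fst xs) v \<beta>)"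
proof (rule poly_mapping_eqI)
  fix r
  have entry: "r < length bs \<and> bs ! r \<preceq> fst (xs ! c)"
    if "c < length xs" "lookup (snd (xs ! c)) r \<noteq> 0" for c
    using graded that(2) nth_mem[OF that(1)] unfolding well_graded_def by blast
  show "lookup (component bs (diff_mat bs xs *\<^sub>v v) \<beta>) r =
      lookup (lincomb xs (component (map fst xs) v \<beta>)) r"
  proof (cases "r < length bs \<and> bs ! r \<preceq> \<beta>")
    case True
    then have r: "r < length bs" "bs ! r \<preceq> \<beta>"
      by auto
    have "lookup (component bs (diff_mat bs xs *\<^sub>v v) \<beta>) r =
        lookup ((diff_mat bs xs *\<^sub>v v) $ r) (\<beta> - bs ! r)"
      using r by (simp add: lookup_component)
    also have "\<dots> = (\<Sum>c<length xs.
        lookup (diff_mat bs xs $$ (r, c) * v $ c) (\<beta> - bs ! r))"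
      unfolding index_mult_mat_vec_sum[OF diff_mat_carrier v r(1)] lookup_sum ..
    also have "\<dots> = (\<Sum>c<length xs.
        lookup (component (map fst xs) v \<beta>) c * lookup (snd (xs ! c)) r)"
    proof (intro sum.cong refl)
      fix c assume "c \<in> {..<length xs}"
      then have c: "c < length xs"
        by simp
      have A_rc: "diff_mat bs xs $$ (r, c) =
          single (fst (xs ! c) - bs ! r) (lookup (snd (xs ! c)) r)"
        using c r(1) by (simp add: diff_mat_def)
      show "lookup (diff_mat bs xs $$ (r, c) * v $ c) (\<beta> - bs ! r) =
          lookup (component (map fst xs) v \<beta>) c * lookup (snd (xs ! c)) r"
      proof (cases "lookup (snd (xs ! c)) r = 0")
        case True
        then show ?thesis
          by (simp only: A_rc single_zero mult_zero_left mult_zero_right lookup_zero)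
      next
        case False
        then have le: "bs ! r \<preceq> fst (xs ! c)"
          using entry[OF c] by blast
        have iff: "fst (xs ! c) - bs ! r \<preceq> \<beta> - bs ! r \<longleftrightarrow> fst (xs ! c) \<preceq> \<beta>"
          using add_mle_iff[of "bs ! r" "fst (xs ! c) - bs ! r" \<beta>] le r(2) by simp
        have "\<beta> - bs ! r - (fst (xs ! c) - bs ! r) = \<beta> - fst (xs ! c)"
          using le diff_diff_add[of \<beta> "bs ! r" "fst (xs ! c) - bs ! r"] by simp
        then show ?thesis
          unfolding A_rc lookup_single_times iff lookup_component
          using c by (simp only: length_map nth_map simp_thms split: if_split)
            (simp add: mult.commute)
      qed
    qed
    finally show ?thesis
      by (simp add: lookup_lincomb)
  next
    case False
    have "lookup (component (map fst xs) v \<beta>) c * lookup (snd (xs ! c)) r = 0"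
      if "c < length xs" for c
    proof (rule ccontr)
      assume "\<not> ?thesis"
      then have "fst (xs ! c) \<preceq> \<beta>" "lookup (snd (xs ! c)) r \<noteq> 0"
        using that by (auto simp: lookup_component split: if_splits)
      then show False
        using entry[OF that] False mle_trans by blast
    qed
    then have "lookup (lincomb xs (component (map fst xs) v \<beta>)) r = 0"
      unfolding lookup_lincomb by (intro sum.neutral) simp
    moreover have "lookup (component bs (diff_mat bs xs *\<^sub>v v) \<beta>) r = 0"
      using False unfolding lookup_component by argo
    ultimately show ?thesis
      by simp
  qed
qed

lemma component_zero [simp]: "component bs (0\<^sub>v (length bs)) \<beta> = 0"
  by (rule poly_mapping_eqI) (simp add: lookup_component)

lemma mat_kernel_diff_mat:
  assumes graded: "well_graded bs xs"
  shows "mat_kernel (diff_mat bs xs) =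
    {v \<in> carrier_vec (length xs). \<forall>\<beta>. component (map fst xs) v \<beta> \<in> syz xs \<beta>}"
proof (intro equalityI subsetI)
  fix v assume "v \<in> mat_kernel (diff_mat bs xs)"
  then have v: "v \<in> carrier_vec (length xs)" "diff_mat bs xs *\<^sub>v v = 0\<^sub>v (length bs)"
    using mat_kernelD[OF diff_mat_carrier] by auto
  then have "lincomb xs (component (map fst xs) v \<beta>) = 0" for \<beta>
    using component_diff_mat[OF graded v(1), of \<beta>] by simp
  then show "v \<in> {v \<in> carrier_vec (length xs). \<forall>\<beta>. component (map fst xs) v \<beta> \<in> syz xs \<beta>}"
    using v(1) keys_component unfolding syz_def by blast
next
  fix v assume "v \<in> {v \<in> carrier_vec (length xs). \<forall>\<beta>. component (map fst xs) v \<beta> \<in> syz xs \<beta>}"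
  then have v: "v \<in> carrier_vec (length xs)"
    and "\<And>\<beta>. lincomb xs (component (map fst xs) v \<beta>) = 0"
    by (auto simp: syz_def)
  then have "component bs (diff_mat bs xs *\<^sub>v v) \<beta> = component bs (0\<^sub>v (length bs)) \<beta>" for \<beta>
    using component_diff_mat[OF graded v, of \<beta>] by simp
  then have "diff_mat bs xs *\<^sub>v v = 0\<^sub>v (length bs)"
    using v by (intro component_eqD[of _ bs] mult_mat_vec_carrier[OF diff_mat_carrier]) auto
  then show "v \<in> mat_kernel (diff_mat bs xs)"
    by (rule mat_kernelI[OF diff_mat_carrier v])
qed

lemma image_diff_mat:
  fixes xs :: "('n::finite, 'k::field) mvec list"
  assumes graded: "well_graded bs xs" and V: "graded_family N bound V" and xs: "min_gens bound V xs"
  shows "{diff_mat bs xs *\<^sub>v v | v. v \<in> carrier_vec (length xs)} =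
    {u \<in> carrier_vec (length bs). \<forall>\<beta>. component bs u \<beta> \<in> V \<beta>}"
proof (intro equalityI subsetI)
  fix u assume "u \<in> {diff_mat bs xs *\<^sub>v v | v. v \<in> carrier_vec (length xs)}"
  then obtain v where v: "v \<in> carrier_vec (length xs)" "u = diff_mat bs xs *\<^sub>v v"
    by blast
  then have "component bs u \<beta> \<in> V \<beta>" for \<beta>
    unfolding min_gens_lincomb[OF V xs] using component_diff_mat[OF graded v(1)] keys_component
    by blast
  moreover have "u \<in> carrier_vec (length bs)"
    unfolding v(2) by (rule mult_mat_vec_carrier[OF diff_mat_carrier v(1)])
  ultimately show "u \<in> {u \<in> carrier_vec (length bs). \<forall>\<beta>. component bs u \<beta> \<in> V \<beta>}"
    by blast
next
  fix u :: "('n, 'k) mpoly vec"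
  assume "u \<in> {u \<in> carrier_vec (length bs). \<forall>\<beta>. component bs u \<beta> \<in> V \<beta>}"
  then have u: "u \<in> carrier_vec (length bs)" "\<And>\<beta>. component bs u \<beta> \<in> V \<beta>"
    by auto
  \<comment> \<open>Preimages are chosen degree by degree. Taking 0 over a zero component leaves
    finitely many nonzero choices, so they assemble to polynomials.\<close>
  have "\<exists>w. keys w \<subseteq> idx_below xs \<beta> \<and> component bs u \<beta> = lincomb xs w \<and>
      (component bs u \<beta> = 0 \<longrightarrow> w = 0)" for \<beta>
  proof (cases "component bs u \<beta> = 0")
    case True
    then show ?thesis
      by (intro exI[of _ 0]) simp
  next
    case False
    then show ?thesis
      using u(2)[of \<beta>] unfolding min_gens_lincomb[OF V xs] by blast
  qed
  then obtain W where W: "\<And>\<beta>. keys (W \<beta>) \<subseteq> idx_below xs \<beta>"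
    "\<And>\<beta>. component bs u \<beta> = lincomb xs (W \<beta>)" "\<And>\<beta>. component bs u \<beta> = 0 \<Longrightarrow> W \<beta> = 0"
    by metis
  define v where "v = vec (length xs) (\<lambda>c. Abs_poly_mapping (\<lambda>g. lookup (W (g + fst (xs ! c))) c))"
  have v: "v \<in> carrier_vec (length xs)"
    by (simp add: v_def)
  have lookup_v: "lookup (v $ c) g = lookup (W (g + fst (xs ! c))) c" if "c < length xs" for c g
  proof -
    have "{g. lookup (W (g + fst (xs ! c))) c \<noteq> 0} \<subseteq>
        (\<lambda>g. g + fst (xs ! c)) -` {\<beta>. component bs u \<beta> \<noteq> 0}"
      using W(3) by fastforce
    moreover have "finite ((\<lambda>g. g + fst (xs ! c)) -` {\<beta>. component bs u \<beta> \<noteq> 0})"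
      by (intro finite_vimageI finite_components) (simp add: inj_on_def)
    ultimately have "finite {g. lookup (W (g + fst (xs ! c))) c \<noteq> 0}"
      by (rule finite_subset)
    then show ?thesis
      using that by (simp add: v_def)
  qed
  have "component (map fst xs) v \<beta> = W \<beta>" for \<beta>
  proof (rule poly_mapping_eqI)
    fix c
    show "lookup (component (map fst xs) v \<beta>) c = lookup (W \<beta>) c"
    proof (cases "c \<in> idx_below xs \<beta>")
      case True
      then show ?thesis
        by (simp add: idx_below_def lookup_component lookup_v)
    next
      case False
      then have "c \<notin> keys (W \<beta>)" "c \<notin> keys (component (map fst xs) v \<beta>)"
        using W(1) keys_component by blast+
      then show ?thesis
        by (simp add: in_keys_iff)
    qed
  qed
  then have "component bs (diff_mat bs xs *\<^sub>v v) \<beta> = component bs u \<beta>" for \<beta>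
    using component_diff_mat[OF graded v] W(2) by simp
  then have "diff_mat bs xs *\<^sub>v v = u"
    using v u(1) by (intro component_eqD[of _ bs] mult_mat_vec_carrier[OF diff_mat_carrier]) auto
  then show "u \<in> {diff_mat bs xs *\<^sub>v v | v. v \<in> carrier_vec (length xs)}"
    using v by blast
qed

text \<open>The ideal itself as a graded family of rank 1: a line in the degrees of
  \<open>M\<close>, zero elsewhere.\<close>

definition base_family :: "('n \<Rightarrow>\<^sub>0 nat) set \<Rightarrow> ('n \<Rightarrow>\<^sub>0 nat) \<Rightarrow> (nat \<Rightarrow>\<^sub>0 'k::field) set"
  where "base_family M \<beta> = {v. keys v \<subseteq> (if \<beta> \<in> M then {0} else {})}"

lemma graded_family_base:
  assumes "up_closed M" "\<And>\<beta>. \<beta> \<in> M \<Longrightarrow> cap bound \<beta> \<in> M"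
  shows "graded_family 1 bound (base_family M)"
  unfolding graded_family_def
proof (intro conjI allI impI ballI)
  fix \<beta>
  show "coord.subspace (base_family M \<beta>)"
    unfolding base_family_def by (rule coord_subspace_keys)
  show "base_family M \<beta> \<subseteq> base_family M (cap bound \<beta>)"
    using assms(2) by (auto simp: base_family_def)
  show "keys v \<subseteq> {..<1}" if "v \<in> base_family M \<beta>" for v
    using that by (auto simp: base_family_def split: if_splits)
  show "base_family M \<beta> \<subseteq> base_family M \<gamma>" if "\<beta> \<preceq> \<gamma>" for \<gamma>
    using up_closedD[OF assms(1) _ that] by (auto simp: base_family_def split: if_splits)
qed

primrec stage ::
  "('n::finite \<Rightarrow>\<^sub>0 nat) \<Rightarrow> ('n \<Rightarrow>\<^sub>0 nat) set \<Rightarrow> nat \<Rightarrow> ('n, 'k::field) mvec list"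
where
  "stage bound M 0 = (SOME xs. min_gens bound (base_family M) xs)"
| "stage bound M (Suc i) = (SOME xs. min_gens bound (syz (stage bound M i)) xs)"

text \<open>A nonzero entry of a differential strictly raises multidegrees, by minimality, while all
  multidegrees stay below \<open>bound\<close>. Hence the resolution is finite.\<close>

theorem ex_min_graded_free_resolution:
  fixes M :: "('n::finite \<Rightarrow>\<^sub>0 nat) set"
  assumes up: "up_closed M" and bound: "\<And>\<beta>. \<beta> \<in> M \<Longrightarrow> cap bound \<beta> \<in> M" and "0 \<notin> M"
  shows "\<exists>D A. min_graded_free_resolution (mono_ideal M :: ('n, 'k::field) mpoly set) D A"
proof -
  define Y where "Y = (stage bound M :: nat \<Rightarrow> ('n, 'k) mvec list)"
  define fam where "fam i = (case i of 0 \<Rightarrow> base_family M | Suc j \<Rightarrow> syz (Y j))" for i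
  define bs where "bs i = (case i of 0 \<Rightarrow> [0] | Suc j \<Rightarrow> map fst (Y j))" for i
  have fam_0: "fam 0 = base_family M" and fam_Suc: "fam (Suc i) = syz (Y i)"
    and bs_0: "bs 0 = [0]" and bs_Suc: "bs (Suc i) = map fst (Y i)" for i
    by (simp_all add: fam_def bs_def)
  have Y: "Y i = (SOME xs. min_gens bound (fam i) xs)" for i
    by (cases i) (simp_all add: Y_def fam_def)
  have graded_fam: "graded_family (length (bs i)) bound (fam i) \<and> min_gens bound (fam i) (Y i)" for i
  proof (induction i)
    case 0
    have "graded_family (length (bs 0)) bound (fam 0)"
      using graded_family_base[OF up bound] by (simp add: fam_0 bs_0)
    then show ?case
      using someI_ex[OF ex_min_gens] Y[of 0] by metis
  next
    case (Suc i)
    then have "\<And>x. x \<in> set (Y i) \<Longrightarrow> fst x \<preceq> bound"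
      by (simp add: min_gens_def generates_def)
    then have "graded_family (length (bs (Suc i))) bound (fam (Suc i))"
      using graded_family_syz[of "Y i" bound] by (simp add: fam_Suc bs_Suc)
    then show ?case
      using someI_ex[OF ex_min_gens] Y[of "Suc i"] by metis
  qed
  then have fam: "graded_family (length (bs i)) bound (fam i)" and gens: "min_gens bound (fam i) (Y i)" for i
    by auto
  have mem: "fst x \<preceq> bound" "snd x \<in> fam i (fst x)" "snd x \<noteq> 0" if "x \<in> set (Y i)" for i x
  proof -
    show "fst x \<preceq> bound" "snd x \<in> fam i (fst x)"
      using gens[of i] that by (auto simp: min_gens_def generates_def)
    show "snd x \<noteq> 0"
      using gens[of i] that coord.span_zero unfolding min_gens_def by metis
  qed
  \<comment> \<open>Strictness comes from \<open>0 \<notin> M\<close> at the first stage and from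
    irredundancy of the preceding generators afterwards.\<close>
  have strict: "r < length (bs i) \<and> bs i ! r \<preceq> fst x \<and> bs i ! r \<noteq> fst x"
    if x: "x \<in> set (Y i)" and r: "lookup (snd x) r \<noteq> 0" for i x r
  proof (cases i)
    case 0
    have "r \<in> keys (snd x)"
      using r by (simp add: in_keys_iff)
    then have "r = 0" "fst x \<in> M"
      using mem(2)[OF x] by (auto simp: 0 fam_0 base_family_def split: if_splits)
    then show ?thesis
      using \<open>0 \<notin> M\<close> by (auto simp: 0 bs_0)
  next
    case (Suc j)
    have syz: "snd x \<in> syz (Y j) (fst x)"
      using mem(2)[OF x] by (simp add: Suc fam_Suc)
    have "r \<in> keys (snd x)"
      using r by (simp add: in_keys_iff)
    then have "r \<in> idx_below (Y j) (fst x)"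
      using syz unfolding syz_def by blast
    then show ?thesis
      using min_gens_syz_neq[OF gens syz r] by (simp add: idx_below_def Suc bs_Suc)
  qed
  then have graded: "well_graded (bs i) (Y i)" for i
    by (simp add: well_graded_def)
  have deg: "i < mdeg (fst x)" if "x \<in> set (Y i)" for i x
    using that
  proof (induction i arbitrary: x)
    case 0
    then have "lookup (snd x) \<noteq> (\<lambda>_. 0)"
      using mem(3) by (metis lookup_zero poly_mapping_eqI)
    then obtain r where "lookup (snd x) r \<noteq> 0"
      by auto
    from strict[OF 0 this] have "fst x \<noteq> 0"
      by (auto simp: bs_0)
    then show ?case
      by (metis gr0I mdeg_eq_0_iff)
  next
    case (Suc i)
    then have "lookup (snd x) \<noteq> (\<lambda>_. 0)"
      using mem(3) by (metis lookup_zero poly_mapping_eqI)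
    then obtain r where "lookup (snd x) r \<noteq> 0"
      by auto
    from strict[OF Suc.prems this] have r: "r < length (Y i)" "fst (Y i ! r) \<preceq> fst x"
      "fst (Y i ! r) \<noteq> fst x"
      by (auto simp: bs_Suc)
    then show ?case
      using Suc.IH[of "Y i ! r"] mdeg_strict_mono[OF r(2,3)] by simp
  qed
  have empty: "Y i = []" if "i \<ge> mdeg bound" for i
  proof (rule ccontr)
    assume "Y i \<noteq> []"
    then have "hd (Y i) \<in> set (Y i)"
      by simp
    then show False
      using deg[of "hd (Y i)" i] mem(1)[of "hd (Y i)" i] mdeg_mono that by fastforce
  qed
  define D where "D i = map mdeg (bs i)" for i
  define A where "A i = diff_mat (bs i) (Y i)" for i
  have D_Suc: "length (D (Suc i)) = length (Y i)" and D_len: "length (D i) = length (bs i)" for i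
    by (simp_all add: D_def bs_Suc)
  have entries: "(\<forall>m\<in>keys (A i $$ (r, c)). mdeg m + D i ! r = D (Suc i) ! c) \<and>
      A i $$ (r, c) \<in> ideal_gen (range Var)"
    if "r < length (D i)" "c < length (D (Suc i))" for i r c
  proof -
    have r: "r < length (bs i)" and c: "c < length (Y i)"
      using that D_Suc[of i] D_len[of i] by simp_all
    then have A: "A i $$ (r, c) = single (fst (Y i ! c) - bs i ! r) (lookup (snd (Y i ! c)) r)"
      by (simp add: A_def diff_mat_def)
    show ?thesis
    proof (cases "lookup (snd (Y i ! c)) r = 0")
      case True
      then show ?thesis
        unfolding A by (simp add: ring_as_module.span_zero)
    next
      case False
      have le: "bs i ! r \<preceq> fst (Y i ! c)" "bs i ! r \<noteq> fst (Y i ! c)"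
        using strict[OF nth_mem[OF c] False] by auto
      have "fst (Y i ! c) - bs i ! r \<noteq> 0"
        using le by (metis add_0 mle_diff_add(1))
      then have "\<exists>j. lookup (fst (Y i ! c) - bs i ! r) j \<noteq> 0"
        by (metis lookup_zero poly_mapping_eqI)
      then have "A i $$ (r, c) \<in> ideal_gen (range Var)"
        unfolding A ideal_gen_Var by simp
      moreover have "mdeg (fst (Y i ! c) - bs i ! r) + D i ! r = D (Suc i) ! c"
        using mdeg_diff[OF le(1)] c r by (simp add: D_def bs_Suc)
      ultimately show ?thesis
        using False by (simp add: A)
    qed
  qed
  have carrier: "A i \<in> carrier_mat (length (D i)) (length (D (Suc i)))" for i
    using diff_mat_carrier[of "bs i" "Y i"] D_Suc[of i] D_len[of i] by (simp add: A_def)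
  have image: "{A i *\<^sub>v v | v. v \<in> carrier_vec (length (Y i))} =
      {u \<in> carrier_vec (length (bs i)). \<forall>\<beta>. component (bs i) u \<beta> \<in> fam i \<beta>}" for i
    unfolding A_def by (rule image_diff_mat[OF graded fam gens])
  \<comment> \<open>Kernel and image are both the set of vectors whose components lie in
    \<open>syz (Y i)\<close>, which the next stage was chosen to generate.\<close>
  have exact: "mat_kernel (A i) =
      {A (Suc i) *\<^sub>v v | v. v \<in> carrier_vec (length (D (Suc (Suc i))))}" for i
    unfolding D_Suc image unfolding A_def mat_kernel_diff_mat[OF graded] bs_Suc fam_Suc
    by simp
  have "{(A 0 *\<^sub>v v) $ 0 | v. v \<in> carrier_vec (length (D 1))} =
      (\<lambda>u. u $ 0) ` {A 0 *\<^sub>v v | v. v \<in> carrier_vec (length (Y 0))}"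
    using D_Suc[of 0] by auto
  also have "\<dots> = (\<lambda>u. u $ 0) ` {u \<in> carrier_vec 1. u $ 0 \<in> mono_ideal M}"
  proof -
    have "(\<forall>\<beta>. component [0] u \<beta> \<in> base_family M \<beta>) \<longleftrightarrow> u $ 0 \<in> mono_ideal M"
      for u :: "('n, 'k) mpoly vec"
    proof -
      have "component [0] u \<beta> \<in> base_family M \<beta> \<longleftrightarrow> (lookup (u $ 0) \<beta> \<noteq> 0 \<longrightarrow> \<beta> \<in> M)" for \<beta>
      proof -
        have "keys (component [0] u \<beta>) = {c. c = 0 \<and> lookup (u $ 0) \<beta> \<noteq> 0}"
        proof (rule Set.set_eqI)
          fix c
          show "c \<in> keys (component [0] u \<beta>) \<longleftrightarrow> c \<in> {c. c = 0 \<and> lookup (u $ 0) \<beta> \<noteq> 0}"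
            by (cases c) (simp_all add: in_keys_iff lookup_component)
        qed
        then show ?thesis
          by (auto simp only: base_family_def mem_Collect_eq split: if_splits)
      qed
      then show ?thesis
        by (auto simp: mono_ideal_def in_keys_iff)
    qed
    then show ?thesis
      by (simp add: image fam_0 bs_0)
  qed
  also have "\<dots> = mono_ideal M"
  proof (intro equalityI subsetI)
    fix f :: "('n, 'k) mpoly" assume "f \<in> mono_ideal M"
    then have "vec 1 (\<lambda>_. f) \<in> {u \<in> carrier_vec 1. u $ 0 \<in> mono_ideal M}" "f = vec 1 (\<lambda>_. f) $ 0"
      by simp_all
    then show "f \<in> (\<lambda>u. u $ 0) ` {u \<in> carrier_vec 1. u $ 0 \<in> mono_ideal M}"
      by blast
  qed auto
  finally have gen_0: "{(A 0 *\<^sub>v v) $ 0 | v. v \<in> carrier_vec (length (D 1))} = mono_ideal M" .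
  have "D i = []" if "i > mdeg bound" for i
    using that empty[of "i - 1"] by (cases i) (simp_all add: D_def bs_Suc)
  then have "min_graded_free_resolution (mono_ideal M) D A"
    unfolding min_graded_free_resolution_def
    using carrier entries gen_0 exact by (auto simp: D_def bs_0)
  then show ?thesis
    by blast
qed

section \<open>The inequality\<close>

text \<open>The degree condition is asked of every resolution because \<open>betti\<close> reads off
  a chosen one. Its finite length bounds the set under \<open>Max\<close>.\<close>

lemma reg_quot_ge:
  fixes J :: "('n::finite, 'k::field) mpoly set"
  assumes ex: "\<exists>D A. min_graded_free_resolution J D A"
    and degree: "\<And>D A. min_graded_free_resolution J D A \<Longrightarrow> j \<in> set (D i)"
  shows "int j - int i \<le> reg_quot J"
proof -
  define D where "D = (SOME D. \<exists>A. min_graded_free_resolution J D A)"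
  obtain A where res: "min_graded_free_resolution J D A"
    using someI_ex[OF ex] unfolding D_def by blast
  then obtain p where p: "\<And>i. i > p \<Longrightarrow> D i = []"
    unfolding min_graded_free_resolution_def by blast
  have betti: "betti J a b \<noteq> 0 \<longleftrightarrow> b \<in> set (D a)" for a b
    by (simp add: betti_def count_list_0_iff flip: D_def)
  let ?R = "{int b - int a | a b. betti J a b \<noteq> 0}"
  have "?R \<subseteq> (\<Union>a\<le>p. (\<lambda>b. int b - int a) ` set (D a))"
  proof
    fix x assume "x \<in> ?R"
    then obtain a b where ab: "x = int b - int a" "b \<in> set (D a)"
      using betti by blast
    then have "a \<le> p"
      using p[of a] by (cases "a \<le> p") auto
    then show "x \<in> (\<Union>a\<le>p. (\<lambda>b. int b - int a) ` set (D a))"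
      using ab by blast
  qed
  then have "finite ?R"
    by (rule finite_subset) simp
  moreover have "int j - int i \<in> ?R"
    using degree[OF res] betti by blast
  ultimately show ?thesis
    unfolding reg_quot_def by (rule Max_ge)
qed

text \<open>\<open>x^f\<close> violates the edge \<open>{p, q}\<close>, so a multiplier must supply
  \<open>x_p\<close> or \<open>x_q\<close>; by the last two assumptions one such factor
  suffices.\<close>

lemma colon_single_edge:
  fixes adj :: "'n::finite \<Rightarrow> 'n \<Rightarrow> bool" and k :: nat
  defines "M \<equiv> edge_ge adj k"
  assumes "adj p q" "p \<noteq> q" and deficient: "lookup f p + lookup f q < k"
    and f: "f + single p 1 \<in> M" "f + single q 1 \<in> M"
  shows "colon (mono_ideal M) (single f 1) =
    (mono_ideal {m. 1 \<le> wt {p, q} m} :: ('n, 'k::field) mpoly set)"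
proof (intro equalityI subsetI)
  fix g :: "('n, 'k) mpoly"
  assume "g \<in> colon (mono_ideal M) (single f 1)"
  then have g: "single f 1 * g \<in> mono_ideal M"
    by (simp add: colon_def mult.commute)
  have "1 \<le> wt {p, q} m" if "m \<in> keys g" for m
  proof -
    have "lookup (single f 1 * g) (f + m) \<noteq> 0"
      using that by (simp add: lookup_single_times in_keys_iff)
    then have "f + m \<in> M"
      using g by (auto simp: mono_ideal_def in_keys_iff)
    then have "k \<le> lookup (f + m) p + lookup (f + m) q"
      using \<open>adj p q\<close> unfolding M_def by (rule edge_geD)
    then show ?thesis
      using deficient \<open>p \<noteq> q\<close> by (simp add: wt_def lookup_add)
  qed
  then show "g \<in> mono_ideal {m. 1 \<le> wt {p, q} m}"
    by (auto simp: mono_ideal_def)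
next
  fix g :: "('n, 'k) mpoly"
  assume g: "g \<in> mono_ideal {m. 1 \<le> wt {p, q} m}"
  have "f + m \<in> M" if "m \<in> keys g" for m
  proof -
    have "1 \<le> wt {p, q} m"
      using g that by (auto simp: mono_ideal_def)
    then have "\<exists>i\<in>{p, q}. lookup m i \<noteq> 0"
      using \<open>p \<noteq> q\<close> by (auto simp: wt_def)
    then obtain i where i: "i = p \<or> i = q" "lookup m i \<noteq> 0"
      by blast
    then have "f + single i 1 \<preceq> f + m"
      by (auto simp: mle_def lookup_add)
    then show ?thesis
      using i(1) f up_closedD[OF up_closed_edge_ge, of _ adj k] unfolding M_def by blast
  qed
  then have "keys (single f 1 * g) \<subseteq> M"
    by (auto elim!: keys_timesE)
  then show "g \<in> colon (mono_ideal M) (single f 1)"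
    by (simp add: colon_def mono_ideal_def mult.commute)
qed

theorem theorem5p3:
  fixes E :: "'n::finite set set" and k :: nat
  assumes "simple_graph E" and "E \<noteq> {}" and "k \<ge> 1"
  shows "int (v_number (symbolic_power (cover_ideal E :: ('n, 'k::field) mpoly set) k))
       \<le> reg_quot (symbolic_power (cover_ideal E :: ('n, 'k) mpoly set) k)"
proof -
  define adj where "adj i j \<longleftrightarrow> {i, j} \<in> E \<and> i \<noteq> j" for i j
  define M where "M = edge_ge adj k"
  define J where "J = (mono_ideal M :: ('n, 'k) mpoly set)"
  have edge: "\<exists>i j. e = {i, j} \<and> i \<noteq> j" if "e \<in> E" for e
    using assms(1) that by (auto simp: simple_graph_def card_2_iff)
  have "(\<forall>e\<in>E. k \<le> wt e m) \<longleftrightarrow> m \<in> M" for m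
  proof
    assume *: "\<forall>e\<in>E. k \<le> wt e m"
    then show "m \<in> M"
      by (force simp: M_def edge_ge_def adj_def wt_def)
  next
    assume m: "m \<in> M"
    show "\<forall>e\<in>E. k \<le> wt e m"
    proof
      fix e assume "e \<in> E"
      with edge[OF this] obtain i j where "e = {i, j}" "i \<noteq> j" "adj i j"
        by (auto simp: adj_def)
      then show "k \<le> wt e m"
        using edge_geD[OF m[unfolded M_def], of i j] by (simp add: wt_def)
    qed
  qed
  then have sym_power: "symbolic_power (cover_ideal E) k = J"
    by (simp add: symbolic_power_cover_ideal[OF assms(1)] J_def)
  have sym: "adj i j \<Longrightarrow> adj j i" and irrefl: "\<not> adj i i" for i j
    by (auto simp: adj_def insert_commute)
  obtain i0 j0 where "adj i0 j0"
    using assms(2) edge unfolding adj_def by blast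
  have "\<exists>b g1 g2 f p q. critical M b g1 g2 \<and> adj p q \<and> lookup f p + lookup f q < k \<and>
      f + single p 1 \<in> M \<and> f + single q 1 \<in> M \<and> b = f + single p 1 + single q 1"
    unfolding M_def
    by (rule critical_multidegree[where adj = adj and ?i0.0 = i0 and ?j0.0 = j0])
      (fact sym irrefl \<open>adj i0 j0\<close> assms(3))+
  then obtain b g1 g2 f p q where crit: "critical M b g1 g2"
    and pq: "adj p q" "lookup f p + lookup f q < k"
    and f: "f + single p 1 \<in> M" "f + single q 1 \<in> M" "b = f + single p 1 + single q 1"
    by blast
  have "p \<noteq> q"
    using pq(1) irrefl by auto
  have mdeg_single: "mdeg (single i (1::nat)) = 1" for i :: 'n
    by (simp add: mdeg_def)
  then have deg_b: "mdeg b = mdeg f + 2"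
    by (simp add: f(3) mdeg_add)

  let ?P = "mono_ideal {m. 1 \<le> wt {p, q} m} :: ('n, 'k) mpoly set"
  have colon: "colon J (single f 1) = ?P"
    unfolding J_def M_def
    using pq \<open>p \<noteq> q\<close> f(1,2) by (intro colon_single_edge) (auto simp: M_def)
  then have "?P \<in> Ass J"
    unfolding Ass_def using prime_ideal_wt by blast
  moreover have "single f (1 :: 'k) \<in> graded_part (mdeg f)"
    by (simp add: graded_part_def)
  ultimately have v: "v_number J \<le> mdeg f"
    unfolding v_number_def using colon by (intro Least_le) blast

  have "\<exists>D A. min_graded_free_resolution J D A"
    unfolding J_def
  proof (rule ex_min_graded_free_resolution)
    show "up_closed M"
      unfolding M_def by (rule up_closed_edge_ge)
    show "0 \<notin> M"
      using edge_geD[of 0 adj k i0 j0] \<open>adj i0 j0\<close> assms(3) by (auto simp: M_def)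
    \<comment> \<open>The constant vector \<open>k\<close> is a valid bound: a coordinate that gets
      cut still equals \<open>k\<close> and satisfies its edges alone.\<close>
    show "cap (mk (\<lambda>_. k)) \<beta> \<in> M" if "\<beta> \<in> M" for \<beta>
      unfolding M_def edge_ge_def
    proof (intro CollectI allI impI)
      fix i j assume "adj i j"
      then have "k \<le> lookup \<beta> i + lookup \<beta> j"
        using that unfolding M_def by (intro edge_geD)
      then show "k \<le> lookup (cap (mk (\<lambda>_. k)) \<beta>) i + lookup (cap (mk (\<lambda>_. k)) \<beta>) j"
        by (simp add: cap_def min_def)
    qed
  qed
  moreover have "mdeg b \<in> set (D 2)" if "min_graded_free_resolution J D A" for D A
    using second_syzygy_degree[OF that[unfolded J_def] crit] .
  ultimately have "int (mdeg b) - int 2 \<le> reg_quot J"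
    by (rule reg_quot_ge)
  then show ?thesis
    unfolding sym_power using v deg_b by linarith
qed

end
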